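(* Let $\mathcal S$ be the $(1+1)$-dimensional centrally extended Schrödinger Lie algebra over $\mathbb R$, with basis $\{D,H,P,K,C,M\}$. All Lie bialgebra structures $(\mathcal S,\delta)$ are coboundary. More precisely, they are the structures defined by the classical $r$-matrices $r\in\mathcal S\wedge\mathcal S$ depending on 15 real coefficients $a_i,b_i,c_j$ ($i=1,\dots,6$; $j=1,2,3$), $$\begin{aligned} r={}&a_1 D\wedge P+a_2 D\wedge H+a_3 P\wedge M+a_4 H\wedge M+a_5 P\wedge H+a_6 P\wedge C\\ &+b_1 D\wedge K+b_2 D\wedge C+b_3 K\wedge M+b_4 C\wedge M+b_5 K\wedge C+b_6 K\wedge H\\ &+c_1 D\wedge M+c_2 P\wedge K+c_3 H\wedge C,\end{aligned}$$ where the coefficients are subject to the following 19 equations: (I) $a_6^2+a_6b_1-3a_1b_5+b_5b_6=0$; $a_2a_3-2a_1a_4-a_4b_6-3a_5c_1+a_5c_2=0$; $a_1a_2+a_2b_6-a_5c_3=0$; $a_5b_1-a_1b_6-2a_2c_1-a_4c_3=0$; $a_4a_6+a_4b_1-a_2b_3-a_5b_4+a_1c_1-a_1c_2=0$; $3a_1b_2-a_2b_5+a_6c_3+b_1c_3=0$; $a_3b_2+2a_1b_4-a_4b_5+a_6c_1+a_6c_2+b_3c_3=0$; $3a_2b_5+b_2b_6-a_6c_3=0$; (II) $b_6^2+b_6a_1-3b_1a_5+a_5a_6=0$; $b_2b_3-2b_1b_4-b_4a_6-3b_5c_1-b_5c_2=0$; $b_1b_2+b_2a_6+b_5c_3=0$;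 $b_5a_1-b_1a_6-2b_2c_1+b_4c_3=0$; $b_4b_6+b_4a_1-b_2a_3-b_5a_4+b_1c_1+b_1c_2=0$; $3b_1a_2-b_2a_5-b_6c_3-a_1c_3=0$; $b_3a_2+2b_1a_4-b_4a_5+b_6c_1-b_6c_2-a_3c_3=0$; $3b_2a_5+a_2a_6+b_6c_3=0$; (III) $4a_2b_2+c_3^2=0$; $2a_4b_2+2a_2b_4+a_5b_5-a_6b_6=0$; $2a_1b_1-a_1a_6-b_1b_6+a_5b_5-a_6b_6=0$. For such $r$ the Schouten bracket is $$[[r,r]]=(a_3a_6+b_3b_6-a_3b_1-a_1b_3-c_2^2)\,K\wedge M\wedge P,$$ so that $r$ is standard if $a_3a_6+b_3b_6-a_3b_1-a_1b_3-c_2^2\neq0$, and non-standard if $a_3a_6+b_3b_6-a_3b_1-a_1b_3-c_2^2=0$.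
   Context: $\mathcal S$ is the real 6-dimensional Lie algebra with basis $\{D,H,P,K,C,M\}$ and brackets $[D,P]=-P$, $[D,K]=K$, $[K,P]=M$, $[D,H]=-2H$, $[D,C]=2C$, $[H,C]=D$, $[K,H]=P$, $[K,C]=0$, $[P,C]=-K$, $[P,H]=0$, $[M,\cdot]=0$. A Lie bialgebra $(g,\delta)$ is a Lie algebra $g$ with a linear map $\delta:g\to g\otimes g$ (cocommutator) such that (i) $\delta([X,Y])=[\delta(X),1\otimes Y+Y\otimes1]+[1\otimes X+X\otimes 1,\delta(Y)]$ for all $X,Y\in g$, and (ii) the dual map $\delta^*:g^*\otimes g^*\to g^*$ is a Lie bracket on $g^*$. It is coboundary if there is a skew-symmetric $r\in g\otimes g$ (classical $r$-matrix) with $\delta(X)=[1\otimes X+X\otimes1,r]$ for all $X\in g$. Convention: $X\wedge Y=X\otimes Y-Y\otimes X$, and $X\wedge Y\wedge Z$ is the full antisymmetrization (signed sum over the six permutations, with no normalizing factor). For $r=r^{ij}X_i\otimes X_j$, set $r_{12}=r^{ij}X_i\otimes X_j\otimes 1$, $r_{13}=r^{ij}X_i\otimes1\otimes X_j$, $r_{23}=r^{ij}1\otimes X_i\otimes X_j$; the Schouten bracket is $[[r,r]]=[r_{12},r_{13}]+[r_{12},r_{23}]+[r_{13},r_{23}]$. A coboundary Lie bialgebra (or its $r$) is non-standard (triangular) if $[[r,r]]=0$, and standard (quasitriangular) if $[[r,r]]\ne0$ and $[X\otimes1\otimes1+1\otimes X\otimes1+1\otimes1\otimes X,[[r,r]]]=0$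 for all $X\in g$. *)

theory Defs
  imports "HOL-Analysis.Analysis"
begin

definition lie_bracket :: "('a::real_vector \<Rightarrow> 'a \<Rightarrow> 'a) \<Rightarrow> bool" where
  "lie_bracket br \<longleftrightarrow>
     bilinear br \<and> (\<forall>x. br x x = 0) \<and>
     (\<forall>x y z. br x (br y z) + br y (br z x) + br z (br x y) = 0)"

text \<open>
  For \<open>g = real ^ 'n\<close> the tensor powers of \<open>g\<close> are modelled by coefficient arrays:
  \<open>t $ i $ j\<close> is the coefficient of \<open>e\<^sub>i \<otimes> e\<^sub>j\<close>, where \<open>e\<^sub>i = axis i 1\<close>.
\<close>

type_synonym 'n tensor2 = "((real, 'n) vec, 'n) vec"
type_synonym 'n tensor3 = "(((real, 'n) vec, 'n) vec, 'n) vec"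

definition tens2 :: "real ^ 'n \<Rightarrow> real ^ 'n \<Rightarrow> ('n::finite) tensor2" where
  "tens2 x y = (\<chi> i j. x $ i * y $ j)"

definition tens3 :: "real ^ 'n \<Rightarrow> real ^ 'n \<Rightarrow> real ^ 'n \<Rightarrow> ('n::finite) tensor3" where
  "tens3 x y z = (\<chi> i j k. x $ i * y $ j * z $ k)"

definition wedge2 :: "real ^ 'n \<Rightarrow> real ^ 'n \<Rightarrow> ('n::finite) tensor2" where
  "wedge2 x y = tens2 x y - tens2 y x"

definition wedge3 :: "real ^ 'n \<Rightarrow> real ^ 'n \<Rightarrow> real ^ 'n \<Rightarrow> ('n::finite) tensor3" where
  "wedge3 x y z = tens3 x y z + tens3 y z x + tens3 z x y
                - tens3 y x z - tens3 x z y - tens3 z y x"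

definition skew2 :: "('n::finite) tensor2 \<Rightarrow> bool" where
  "skew2 t \<longleftrightarrow> (\<forall>i j. t $ i $ j = - t $ j $ i)"

text \<open>
  \<open>comm2_left br X t = [1 \<otimes> X + X \<otimes> 1, t]\<close> and
  \<open>comm2_right br t Y = [t, 1 \<otimes> Y + Y \<otimes> 1]\<close>, extended linearly in \<open>t\<close> from
  \<open>[1 \<otimes> X + X \<otimes> 1, a \<otimes> b] = [X, a] \<otimes> b + a \<otimes> [X, b]\<close>; similarly \<open>comm3_left\<close>
  for the three-fold tensor power.
\<close>

definition comm2_left ::
  "(real ^ 'n \<Rightarrow> real ^ 'n \<Rightarrow> real ^ 'n) \<Rightarrow> real ^ 'n \<Rightarrow> ('n::finite) tensor2 \<Rightarrow> 'n tensor2" where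
  "comm2_left br X t = (\<Sum>i\<in>UNIV. \<Sum>j\<in>UNIV. (t $ i $ j) *\<^sub>R
     (tens2 (br X (axis i 1)) (axis j 1) + tens2 (axis i 1) (br X (axis j 1))))"

definition comm2_right ::
  "(real ^ 'n \<Rightarrow> real ^ 'n \<Rightarrow> real ^ 'n) \<Rightarrow> ('n::finite) tensor2 \<Rightarrow> real ^ 'n \<Rightarrow> 'n tensor2" where
  "comm2_right br t Y = (\<Sum>i\<in>UNIV. \<Sum>j\<in>UNIV. (t $ i $ j) *\<^sub>R
     (tens2 (br (axis i 1) Y) (axis j 1) + tens2 (axis i 1) (br (axis j 1) Y)))"

definition comm3_left ::
  "(real ^ 'n \<Rightarrow> real ^ 'n \<Rightarrow> real ^ 'n) \<Rightarrow> real ^ 'n \<Rightarrow> ('n::finite) tensor3 \<Rightarrow> 'n tensor3" where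
  "comm3_left br X t = (\<Sum>i\<in>UNIV. \<Sum>j\<in>UNIV. \<Sum>k\<in>UNIV. (t $ i $ j $ k) *\<^sub>R
     (tens3 (br X (axis i 1)) (axis j 1) (axis k 1)
      + tens3 (axis i 1) (br X (axis j 1)) (axis k 1)
      + tens3 (axis i 1) (axis j 1) (br X (axis k 1))))"

text \<open>The three summands are \<open>[r\<^sub>1\<^sub>2, r\<^sub>1\<^sub>3]\<close>, \<open>[r\<^sub>1\<^sub>2, r\<^sub>2\<^sub>3]\<close> and \<open>[r\<^sub>1\<^sub>3, r\<^sub>2\<^sub>3]\<close>.\<close>

definition schouten ::
  "(real ^ 'n \<Rightarrow> real ^ 'n \<Rightarrow> real ^ 'n) \<Rightarrow> ('n::finite) tensor2 \<Rightarrow> 'n tensor3" where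
  "schouten br r =
     (\<Sum>i\<in>UNIV. \<Sum>j\<in>UNIV. \<Sum>k\<in>UNIV. \<Sum>l\<in>UNIV. (r $ i $ j * r $ k $ l) *\<^sub>R
       (tens3 (br (axis i 1) (axis k 1)) (axis j 1) (axis l 1)
        + tens3 (axis i 1) (br (axis j 1) (axis k 1)) (axis l 1)
        + tens3 (axis i 1) (axis k 1) (br (axis j 1) (axis l 1))))"

text \<open>
  The dual space of \<open>g\<close> is the type \<open>g \<Rightarrow>\<^sub>L real\<close>; the dual map sends \<open>\<phi> \<otimes> \<psi>\<close> to
  \<open>X \<mapsto> (\<phi> \<otimes> \<psi>) (\<delta> X)\<close>. The argument of \<open>Blinfun\<close> is bounded linear
  whenever \<open>\<delta>\<close> is linear.
\<close>

definition dual_map ::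
  "(real ^ 'n \<Rightarrow> 'n tensor2) \<Rightarrow> ((real ^ 'n) \<Rightarrow>\<^sub>L real) \<Rightarrow> ((real ^ 'n) \<Rightarrow>\<^sub>L real)
     \<Rightarrow> ((real ^ ('n::finite)) \<Rightarrow>\<^sub>L real)" where
  "dual_map \<delta> \<phi> \<psi> = Blinfun (\<lambda>X. \<Sum>i\<in>UNIV. \<Sum>j\<in>UNIV.
     \<delta> X $ i $ j * blinfun_apply \<phi> (axis i 1) * blinfun_apply \<psi> (axis j 1))"

definition lie_bialgebra ::
  "(real ^ 'n \<Rightarrow> real ^ 'n \<Rightarrow> real ^ 'n) \<Rightarrow> (real ^ 'n \<Rightarrow> ('n::finite) tensor2) \<Rightarrow> bool" where
  "lie_bialgebra br \<delta> \<longleftrightarrow>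
     lie_bracket br \<and> linear \<delta> \<and>
     (\<forall>X Y. \<delta> (br X Y) = comm2_right br (\<delta> X) Y + comm2_left br X (\<delta> Y)) \<and>
     lie_bracket (dual_map \<delta>)"

definition cocomm ::
  "(real ^ 'n \<Rightarrow> real ^ 'n \<Rightarrow> real ^ 'n) \<Rightarrow> 'n tensor2 \<Rightarrow> real ^ 'n \<Rightarrow> ('n::finite) tensor2" where
  "cocomm br r = (\<lambda>X. comm2_left br X r)"

definition coboundary ::
  "(real ^ 'n \<Rightarrow> real ^ 'n \<Rightarrow> real ^ 'n) \<Rightarrow> (real ^ 'n \<Rightarrow> ('n::finite) tensor2) \<Rightarrow> bool" where
  "coboundary br \<delta> \<longleftrightarrow> (\<exists>r. skew2 r \<and> \<delta> = cocomm br r)"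

definition classical_r_matrix ::
  "(real ^ 'n \<Rightarrow> real ^ 'n \<Rightarrow> real ^ 'n) \<Rightarrow> ('n::finite) tensor2 \<Rightarrow> bool" where
  "classical_r_matrix br r \<longleftrightarrow> skew2 r \<and> lie_bialgebra br (cocomm br r)"

definition nonstandard_r ::
  "(real ^ 'n \<Rightarrow> real ^ 'n \<Rightarrow> real ^ 'n) \<Rightarrow> ('n::finite) tensor2 \<Rightarrow> bool" where
  "nonstandard_r br r \<longleftrightarrow> classical_r_matrix br r \<and> schouten br r = 0"

definition standard_r ::
  "(real ^ 'n \<Rightarrow> real ^ 'n \<Rightarrow> real ^ 'n) \<Rightarrow> ('n::finite) tensor2 \<Rightarrow> bool" where
  "standard_r br r \<longleftrightarrow> classical_r_matrix br r \<and>
     schouten br r \<noteq> 0 \<and> (\<forall>X. comm3_left br X (schouten br r) = 0)"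

datatype gen = GD | GH | GP | GK | GC | GM

lemma UNIV_gen: "UNIV = {GD, GH, GP, GK, GC, GM}"
  by (auto intro: gen.exhaust)

instance gen :: finite
  by standard (simp add: UNIV_gen)

abbreviation "eD \<equiv> (axis GD 1 :: real ^ gen)"
abbreviation "eH \<equiv> (axis GH 1 :: real ^ gen)"
abbreviation "eP \<equiv> (axis GP 1 :: real ^ gen)"
abbreviation "eK \<equiv> (axis GK 1 :: real ^ gen)"
abbreviation "eC \<equiv> (axis GC 1 :: real ^ gen)"
abbreviation "eM \<equiv> (axis GM 1 :: real ^ gen)"

text \<open>
  \<open>sch_table\<close> lists each nonzero bracket of two basis elements in one order only;
  \<open>sch_bracket\<close> is its antisymmetric bilinear extension.
\<close>

fun sch_table :: "gen \<Rightarrow> gen \<Rightarrow> real ^ gen" where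
  "sch_table GD GP = - eP"
| "sch_table GD GK = eK"
| "sch_table GK GP = eM"
| "sch_table GD GH = - (2 *\<^sub>R eH)"
| "sch_table GD GC = 2 *\<^sub>R eC"
| "sch_table GH GC = eD"
| "sch_table GK GH = eP"
| "sch_table GP GC = - eK"
| "sch_table _ _ = 0"

definition sch_bracket :: "real ^ gen \<Rightarrow> real ^ gen \<Rightarrow> real ^ gen" where
  "sch_bracket x y =
     (\<Sum>i\<in>UNIV. \<Sum>j\<in>UNIV. (x $ i * y $ j) *\<^sub>R (sch_table i j - sch_table j i))"

lemma sch_bracket_axis:
  "sch_bracket (axis i 1) (axis j 1) = sch_table i j - sch_table j i"
proof -
  have "sch_bracket (axis i 1) (axis j 1) =
      (\<Sum>k\<in>UNIV. \<Sum>l\<in>UNIV. if k = i \<and> l = j then sch_table k l - sch_table l k else 0)"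
    unfolding sch_bracket_def
    by (intro sum.cong refl) (auto simp: axis_def)
  also have "\<dots> = (\<Sum>k\<in>UNIV. if k = i then sch_table k j - sch_table j k else 0)"
    by (intro sum.cong refl) auto
  finally show ?thesis by simp
qed

lemma sch_brackets:
  "sch_bracket eD eP = - eP" "sch_bracket eD eK = eK" "sch_bracket eK eP = eM"
  "sch_bracket eD eH = - (2 *\<^sub>R eH)" "sch_bracket eD eC = 2 *\<^sub>R eC" "sch_bracket eH eC = eD"
  "sch_bracket eK eH = eP" "sch_bracket eK eC = 0" "sch_bracket eP eC = - eK"
  "sch_bracket eP eH = 0"
  "sch_bracket eM eD = 0" "sch_bracket eM eH = 0" "sch_bracket eM eP = 0"
  "sch_bracket eM eK = 0" "sch_bracket eM eC = 0" "sch_bracket eM eM = 0"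
  by (simp_all add: sch_bracket_axis)

definition sch_r ::
  "real \<Rightarrow> real \<Rightarrow> real \<Rightarrow> real \<Rightarrow> real \<Rightarrow> real \<Rightarrow> real \<Rightarrow> real \<Rightarrow> real \<Rightarrow> real
   \<Rightarrow> real \<Rightarrow> real \<Rightarrow> real \<Rightarrow> real \<Rightarrow> real \<Rightarrow> gen tensor2" where
  "sch_r a1 a2 a3 a4 a5 a6 b1 b2 b3 b4 b5 b6 c1 c2 c3 =
     a1 *\<^sub>R wedge2 eD eP + a2 *\<^sub>R wedge2 eD eH + a3 *\<^sub>R wedge2 eP eM
   + a4 *\<^sub>R wedge2 eH eM + a5 *\<^sub>R wedge2 eP eH + a6 *\<^sub>R wedge2 eP eC
   + b1 *\<^sub>R wedge2 eD eK + b2 *\<^sub>R wedge2 eD eC + b3 *\<^sub>R wedge2 eK eM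
   + b4 *\<^sub>R wedge2 eC eM + b5 *\<^sub>R wedge2 eK eC + b6 *\<^sub>R wedge2 eK eH
   + c1 *\<^sub>R wedge2 eD eM + c2 *\<^sub>R wedge2 eP eK + c3 *\<^sub>R wedge2 eH eC"

definition sch_equations ::
  "real \<Rightarrow> real \<Rightarrow> real \<Rightarrow> real \<Rightarrow> real \<Rightarrow> real \<Rightarrow> real \<Rightarrow> real \<Rightarrow> real \<Rightarrow> real
   \<Rightarrow> real \<Rightarrow> real \<Rightarrow> real \<Rightarrow> real \<Rightarrow> real \<Rightarrow> bool" where
  "sch_equations a1 a2 a3 a4 a5 a6 b1 b2 b3 b4 b5 b6 c1 c2 c3 \<longleftrightarrow>
     a6^2 + a6*b1 - 3*a1*b5 + b5*b6 = 0 \<and>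
     a2*a3 - 2*a1*a4 - a4*b6 - 3*a5*c1 + a5*c2 = 0 \<and>
     a1*a2 + a2*b6 - a5*c3 = 0 \<and>
     a5*b1 - a1*b6 - 2*a2*c1 - a4*c3 = 0 \<and>
     a4*a6 + a4*b1 - a2*b3 - a5*b4 + a1*c1 - a1*c2 = 0 \<and>
     3*a1*b2 - a2*b5 + a6*c3 + b1*c3 = 0 \<and>
     a3*b2 + 2*a1*b4 - a4*b5 + a6*c1 + a6*c2 + b3*c3 = 0 \<and>
     3*a2*b5 + b2*b6 - a6*c3 = 0 \<and>
     b6^2 + b6*a1 - 3*b1*a5 + a5*a6 = 0 \<and>
     b2*b3 - 2*b1*b4 - b4*a6 - 3*b5*c1 - b5*c2 = 0 \<and>
     b1*b2 + b2*a6 + b5*c3 = 0 \<and>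
     b5*a1 - b1*a6 - 2*b2*c1 + b4*c3 = 0 \<and>
     b4*b6 + b4*a1 - b2*a3 - b5*a4 + b1*c1 + b1*c2 = 0 \<and>
     3*b1*a2 - b2*a5 - b6*c3 - a1*c3 = 0 \<and>
     b3*a2 + 2*b1*a4 - b4*a5 + b6*c1 - b6*c2 - a3*c3 = 0 \<and>
     3*b2*a5 + a2*a6 + b6*c3 = 0 \<and>
     4*a2*b2 + c3^2 = 0 \<and>
     2*a4*b2 + 2*a2*b4 + a5*b5 - a6*b6 = 0 \<and>
     2*a1*b1 - a1*a6 - b1*b6 + a5*b5 - a6*b6 = 0"

end

theory Submission
  imports Defs
begin

text \<open>
  For every Lie algebra and every skew \<open>r\<close>, the tensor measuring the failure of the co-Jacobi identity of
  \<open>cocomm br r\<close> at \<open>X\<close> is the adjoint action of \<open>X\<close> on the Schouten bracket of \<open>r\<close>; so a coboundary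
  structure is a Lie bialgebra iff the Schouten bracket is invariant. For the Schroedinger algebra the
  invariant skew 3-tensors are the multiples of \<open>K \<and> M \<and> P\<close>, and the 19 equations say that the
  other 19 independent components of the Schouten bracket vanish.

  For coboundarity, subtract from a cocycle \<open>\<delta>\<close> a coboundary cancelling the part of \<open>\<delta> D\<close> of nonzero
  weight and three further components. The remaining cocycle vanishes at \<open>D\<close>, hence preserves
  weights, and the few surviving components are killed by the cocycle condition.
\<close>

section \<open>Coordinates of the tensor operations\<close>

lemma axis_sum_delta:
  fixes f :: "'n::finite \<Rightarrow> real"
  shows "(\<Sum>i\<in>UNIV. f i * axis i 1 $ a) = f a" "(\<Sum>i\<in>UNIV. axis i 1 $ a * f i) = f a"
  by (simp_all add: axis_def if_distrib [of "\<lambda>x. _ * x"] if_distrib [of "\<lambda>x. x * _"] cong: if_cong)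

lemma linear_expand:
  fixes f :: "real ^ 'n::finite \<Rightarrow> 'a::real_vector"
  assumes "linear f"
  shows "f x = (\<Sum>i\<in>UNIV. x $ i *\<^sub>R f (axis i 1))"
proof -
  have "f x = f (\<Sum>i\<in>UNIV. x $ i *\<^sub>R axis i 1)"
    using basis_expansion [of x] by (simp add: scalar_mult_eq_scaleR)
  then show ?thesis
    by (simp add: linear_sum [OF assms] linear_cmul [OF assms])
qed

lemma linear_expand_nth:
  fixes f :: "real ^ 'n::finite \<Rightarrow> real ^ 'm::finite"
  assumes "linear f"
  shows "f x $ a = (\<Sum>i\<in>UNIV. x $ i * f (axis i 1) $ a)"
  by (subst linear_expand [OF assms]) simp

lemma bilinear_expand_nth:
  fixes br :: "real ^ 'n \<Rightarrow> real ^ 'n \<Rightarrow> real ^ 'm::finite"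
  assumes "bilinear br"
  shows "br x y $ a = (\<Sum>i\<in>UNIV. \<Sum>j\<in>UNIV. x $ i * y $ j * br (axis i 1) (axis j 1) $ a)"
proof -
  have 1: "linear (\<lambda>x. br x y)" and 2: "\<And>x. linear (br x)"
    using assms by (auto simp: bilinear_def)
  have "br x y $ a = (\<Sum>i\<in>UNIV. x $ i * br (axis i 1) y $ a)"
    by (rule linear_expand_nth [OF 1])
  also have "\<dots> = (\<Sum>i\<in>UNIV. x $ i * (\<Sum>j\<in>UNIV. y $ j * br (axis i 1) (axis j 1) $ a))"
    by (simp only: linear_expand_nth [OF 2, of _ y])
  finally show ?thesis by (simp add: sum_distrib_left mult_ac)
qed

text \<open>On the leg that \<open>X\<close> does not touch, the sum over basis vectors is a
  Kronecker delta and collapses. What remains is \<open>br X\<close> applied to a slice of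
  \<open>t\<close>: a column for the first leg, a row for the second. The coordinate formulas below
  arise in the same way.\<close>

lemma comm2_left_nth:
  fixes br :: "real ^ 'n \<Rightarrow> real ^ 'n \<Rightarrow> real ^ 'n::finite"
  assumes "bilinear br"
  shows "comm2_left br X t $ a $ b = br X (column b t) $ a + br X (row a t) $ b"
proof -
  have l: "linear (br X)" using assms by (auto simp: bilinear_def)
  have "comm2_left br X t $ a $ b =
      (\<Sum>i\<in>UNIV. (\<Sum>j\<in>UNIV. (t $ i $ j * br X (axis i 1) $ a) * axis j 1 $ b))
    + (\<Sum>i\<in>UNIV. (\<Sum>j\<in>UNIV. (t $ i $ j * br X (axis j 1) $ b)) * axis i 1 $ a)"
    by (simp add: comm2_left_def tens2_def sum.distrib sum_distrib_left sum_distrib_right distrib_left mult_ac)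
  also have "\<dots> = (\<Sum>i\<in>UNIV. t $ i $ b * br X (axis i 1) $ a)
      + (\<Sum>j\<in>UNIV. t $ a $ j * br X (axis j 1) $ b)"
    by (simp only: axis_sum_delta)
  finally show ?thesis
    by (subst (1 2) linear_expand_nth [OF l]) (simp add: column_def row_def)
qed

lemma comm2_right_nth:
  fixes br :: "real ^ 'n \<Rightarrow> real ^ 'n \<Rightarrow> real ^ 'n::finite"
  assumes "bilinear br"
  shows "comm2_right br t Y $ a $ b = br (column b t) Y $ a + br (row a t) Y $ b"
proof -
  have l: "linear (\<lambda>x. br x Y)" using assms by (auto simp: bilinear_def)
  have "comm2_right br t Y $ a $ b =
      (\<Sum>i\<in>UNIV. (\<Sum>j\<in>UNIV. (t $ i $ j * br (axis i 1) Y $ a) * axis j 1 $ b))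
    + (\<Sum>i\<in>UNIV. (\<Sum>j\<in>UNIV. (t $ i $ j * br (axis j 1) Y $ b)) * axis i 1 $ a)"
    by (simp add: comm2_right_def tens2_def sum.distrib sum_distrib_left sum_distrib_right distrib_left mult_ac)
  also have "\<dots> = (\<Sum>i\<in>UNIV. t $ i $ b * br (axis i 1) Y $ a)
      + (\<Sum>j\<in>UNIV. t $ a $ j * br (axis j 1) Y $ b)"
    by (simp only: axis_sum_delta)
  finally show ?thesis
    by (subst (1 2) linear_expand_nth [OF l]) (simp add: column_def row_def)
qed

lemma comm3_left_nth:
  fixes br :: "real ^ 'n \<Rightarrow> real ^ 'n \<Rightarrow> real ^ 'n::finite"
  assumes "bilinear br"
  shows "comm3_left br X t $ a $ b $ c =
    br X (\<chi> p. t $ p $ b $ c) $ a + br X (\<chi> p. t $ a $ p $ c) $ b + br X (\<chi> p. t $ a $ b $ p) $ c"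
proof -
  have l: "linear (br X)" using assms by (auto simp: bilinear_def)
  have "comm3_left br X t $ a $ b $ c =
      (\<Sum>i\<in>UNIV. \<Sum>j\<in>UNIV. (\<Sum>k\<in>UNIV. (t $ i $ j $ k * br X (axis i 1) $ a) * axis k 1 $ c) * axis j 1 $ b)
    + (\<Sum>i\<in>UNIV. (\<Sum>j\<in>UNIV. \<Sum>k\<in>UNIV. (t $ i $ j $ k * br X (axis j 1) $ b) * axis k 1 $ c) * axis i 1 $ a)
    + (\<Sum>i\<in>UNIV. (\<Sum>j\<in>UNIV. (\<Sum>k\<in>UNIV. t $ i $ j $ k * br X (axis k 1) $ c) * axis j 1 $ b) * axis i 1 $ a)"
    by (simp add: comm3_left_def tens3_def sum.distrib sum_distrib_left sum_distrib_right distrib_left mult_ac)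
  also have "\<dots> = (\<Sum>i\<in>UNIV. t $ i $ b $ c * br X (axis i 1) $ a)
      + (\<Sum>j\<in>UNIV. t $ a $ j $ c * br X (axis j 1) $ b)
      + (\<Sum>k\<in>UNIV. t $ a $ b $ k * br X (axis k 1) $ c)"
    by (simp only: axis_sum_delta)
  finally show ?thesis
    by (subst (1 2 3) linear_expand_nth [OF l]) simp
qed

text \<open>In each of the three commutators two of the four indices sit alone on a leg and are
  fixed by the entry. The other two are contracted, which gives the bracket of two slices of
  \<open>r\<close>.\<close>

lemma schouten_nth:
  fixes br :: "real ^ 'n \<Rightarrow> real ^ 'n \<Rightarrow> real ^ 'n::finite"
  assumes "bilinear br"
  shows "schouten br r $ a $ b $ c =
    br (column b r) (column c r) $ a + br (row a r) (column c r) $ b + br (row a r) (row b r) $ c"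
proof -
  have "schouten br r $ a $ b $ c =
      (\<Sum>i\<in>UNIV. \<Sum>j\<in>UNIV. (\<Sum>k\<in>UNIV. \<Sum>l\<in>UNIV. (r $ i $ j * r $ k $ l * br (axis i 1) (axis k 1) $ a) * axis l 1 $ c) * axis j 1 $ b)
    + (\<Sum>i\<in>UNIV. (\<Sum>j\<in>UNIV. \<Sum>k\<in>UNIV. \<Sum>l\<in>UNIV. (r $ i $ j * r $ k $ l * br (axis j 1) (axis k 1) $ b) * axis l 1 $ c) * axis i 1 $ a)
    + (\<Sum>i\<in>UNIV. (\<Sum>j\<in>UNIV. \<Sum>k\<in>UNIV. (\<Sum>l\<in>UNIV. r $ i $ j * r $ k $ l * br (axis j 1) (axis l 1) $ c) * axis k 1 $ b) * axis i 1 $ a)"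
    by (simp add: schouten_def tens3_def sum.distrib sum_distrib_left sum_distrib_right distrib_left mult_ac)
  also have "\<dots> = (\<Sum>i\<in>UNIV. \<Sum>k\<in>UNIV. r $ i $ b * r $ k $ c * br (axis i 1) (axis k 1) $ a)
      + (\<Sum>j\<in>UNIV. \<Sum>k\<in>UNIV. r $ a $ j * r $ k $ c * br (axis j 1) (axis k 1) $ b)
      + (\<Sum>j\<in>UNIV. \<Sum>l\<in>UNIV. r $ a $ j * r $ b $ l * br (axis j 1) (axis l 1) $ c)"
    by (simp only: axis_sum_delta)
  finally show ?thesis
    unfolding bilinear_expand_nth [OF assms, of "column b r"] bilinear_expand_nth [OF assms, of "row a r"]
    by (simp add: column_def row_def)
qed

section \<open>Invariance of the Schouten bracket\<close>

lemma lie_bracketD: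
  assumes "lie_bracket br"
  shows "bilinear br" "br x y = - br y x"
    "br x (br y z) = br (br x y) z - br (br x z) y"
proof -
  show b: "bilinear br" using assms by (simp add: lie_bracket_def)
  have s: "br x x = 0" for x using assms by (simp add: lie_bracket_def)
  have a: "br x y = - br y x" for x y
    using s [of "x + y"] s [of x] s [of y]
    by (simp add: bilinear_ladd [OF b] bilinear_radd [OF b] eq_neg_iff_add_eq_0 add.commute)
  show "br x y = - br y x" by (rule a)
  have "br x (br y z) + br y (br z x) + br z (br x y) = 0"
    using assms by (simp add: lie_bracket_def)
  moreover have "br y (br z x) = br (br x z) y"
    using a [of y "br z x"] a [of z x] by (simp add: bilinear_lneg [OF b])
  moreover have "br z (br x y) = - br (br x y) z" by (rule a)
  ultimately show "br x (br y z) = br (br x y) z - br (br x z) y"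
    by (simp add: algebra_simps eq_neg_iff_add_eq_0)
qed

lemma skew2D: "skew2 t \<Longrightarrow> t $ i $ j = - t $ j $ i"
  unfolding skew2_def by blast

lemma row_skew2: "skew2 r \<Longrightarrow> row a r = - column a r"
  by (simp add: row_def column_def vec_eq_iff skew2D [of r a])

lemma cocomm_nth:
  assumes "bilinear br" "skew2 r"
  shows "cocomm br r X $ a $ b = br X (column b r) $ a - br X (column a r) $ b"
  using assms by (simp add: cocomm_def comm2_left_nth row_skew2 bilinear_rneg)

lemma skew2_cocomm: "bilinear br \<Longrightarrow> skew2 r \<Longrightarrow> skew2 (cocomm br r X)"
  by (subst skew2_def) (simp add: cocomm_nth)

lemma linear_cocomm: "bilinear br \<Longrightarrow> linear (cocomm br r)"
  by (rule linearI)
    (simp_all add: vec_eq_iff cocomm_def comm2_left_nth bilinear_ladd bilinear_lmul algebra_simps)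

text \<open>Since rows are negated columns, the three commutators become the cyclic rotations of one
  expression in the columns. Cyclic invariance and total skewness can be read off from this
  form.\<close>

lemma schouten_nth_skew2:
  assumes "lie_bracket br" "skew2 r"
  shows "schouten br r $ a $ b $ c = br (column b r) (column c r) $ a
    + br (column c r) (column a r) $ b + br (column a r) (column b r) $ c"
proof -
  note b = lie_bracketD(1) [OF assms(1)]
  have "br (row a r) (column c r) = br (column c r) (column a r)"
    using lie_bracketD(2) [OF assms(1), of "column a r"]
    by (simp add: row_skew2 [OF assms(2)] bilinear_lneg [OF b])
  then show ?thesis
    by (simp add: schouten_nth [OF b] row_skew2 [OF assms(2)] bilinear_lneg [OF b] bilinear_rneg [OF b])
qed

text \<open>Two adjacent transpositions suffice because they generate all permutations of the three
  legs.\<close>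

definition skew3 :: "'n::finite tensor3 \<Rightarrow> bool" where
  "skew3 t \<longleftrightarrow> (\<forall>a b c. t $ a $ b $ c = - t $ b $ a $ c \<and> t $ a $ b $ c = - t $ a $ c $ b)"

lemma skew3_schouten:
  assumes "lie_bracket br" "skew2 r"
  shows "skew3 (schouten br r)"
  unfolding skew3_def
proof (intro allI)
  fix a b c
  have *: "br (column i r) (column j r) $ k = - br (column j r) (column i r) $ k" for i j k
    by (subst lie_bracketD(2) [OF assms(1)]) simp
  show "schouten br r $ a $ b $ c = - schouten br r $ b $ a $ c \<and>
      schouten br r $ a $ b $ c = - schouten br r $ a $ c $ b"
    using * [of a b c] * [of b c a] * [of c a b]
    by (simp add: schouten_nth_skew2 [OF assms])
qed

lemma skew3_comm3_left:
  assumes "bilinear br" "skew3 t"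
  shows "skew3 (comm3_left br X t)"
proof -
  have t: "t $ a $ b $ c = - t $ b $ a $ c" "t $ a $ b $ c = - t $ a $ c $ b" for a b c
    using assms(2) unfolding skew3_def by blast+
  have n: "br X (\<chi> p. f p) $ a = - br X (\<chi> p. g p) $ a" if "\<And>p. f p = - g p" for f g a
  proof -
    have "(\<chi> p. f p) = - (\<chi> p. g p)" using that by (simp add: vec_eq_iff)
    then show ?thesis by (simp add: bilinear_rneg [OF assms(1)])
  qed
  show ?thesis
    unfolding skew3_def comm3_left_nth [OF assms(1)]
  proof (intro allI)
    fix a b c
    \<comment> \<open>The first three equations exchange the legs \<open>a\<close> and
      \<open>b\<close>, the last three exchange \<open>b\<close> and \<open>c\<close>; in each, one
      slice of \<open>t\<close> changes sign.\<close>
    have e: "br X (\<chi> p. t $ p $ b $ c) $ a = - br X (\<chi> p. t $ b $ p $ c) $ a"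
      "br X (\<chi> p. t $ a $ p $ c) $ b = - br X (\<chi> p. t $ p $ a $ c) $ b"
      "br X (\<chi> p. t $ a $ b $ p) $ c = - br X (\<chi> p. t $ b $ a $ p) $ c"
      "br X (\<chi> p. t $ p $ b $ c) $ a = - br X (\<chi> p. t $ p $ c $ b) $ a"
      "br X (\<chi> p. t $ a $ p $ c) $ b = - br X (\<chi> p. t $ a $ c $ p) $ b"
      "br X (\<chi> p. t $ a $ b $ p) $ c = - br X (\<chi> p. t $ a $ p $ b) $ c"
      by (rule n, rule t)+
    show "br X (\<chi> p. t $ p $ b $ c) $ a + br X (\<chi> p. t $ a $ p $ c) $ b + br X (\<chi> p. t $ a $ b $ p) $ c =
        - (br X (\<chi> p. t $ p $ a $ c) $ b + br X (\<chi> p. t $ b $ p $ c) $ a + br X (\<chi> p. t $ b $ a $ p) $ c) \<and>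
        br X (\<chi> p. t $ p $ b $ c) $ a + br X (\<chi> p. t $ a $ p $ c) $ b + br X (\<chi> p. t $ a $ b $ p) $ c =
        - (br X (\<chi> p. t $ p $ c $ b) $ a + br X (\<chi> p. t $ a $ p $ b) $ c + br X (\<chi> p. t $ a $ c $ p) $ b)"
      using e by simp
  qed
qed

section \<open>The co-Jacobi tensor of a coboundary structure\<close>

text \<open>The cyclic sum of \<open>(1 \<otimes> \<delta>) (\<delta> X)\<close>.\<close>

definition co_jacobiator :: "(real ^ 'n \<Rightarrow> 'n tensor2) \<Rightarrow> real ^ 'n \<Rightarrow> ('n::finite) tensor3" where
  "co_jacobiator \<delta> X = (\<chi> a b c. \<Sum>m\<in>UNIV. \<delta> X $ a $ m * \<delta> (axis m 1) $ b $ c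
     + \<delta> X $ b $ m * \<delta> (axis m 1) $ c $ a + \<delta> X $ c $ m * \<delta> (axis m 1) $ a $ b)"

text \<open>Both sides are written as cyclic sums of brackets of the columns \<open>R a\<close> of
  \<open>r\<close>. The terms with \<open>W\<close>, where \<open>X\<close> acts on the column
  index, agree directly; the iterated brackets agree by the Jacobi identity.\<close>

lemma co_jacobiator_cocomm:
  assumes L: "lie_bracket br" and r: "skew2 r"
  shows "co_jacobiator (cocomm br r) X = comm3_left br X (schouten br r)"
proof -
  note b = lie_bracketD(1) [OF L]
  have l: "linear (br x)" "linear (\<lambda>x. br x y)" for x y
    using b by (auto simp: bilinear_def)
  define R where "R a = column a r" for a
  define W where "W a = (\<chi> m. br X (R m) $ a)" for a
  define E where "E p = br X (axis p 1)" for p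
  \<comment> \<open>Skewness of \<open>r\<close> turns the row index in \<open>W a\<close> into a
    column index, so \<open>W a\<close> is a linear combination of the columns
    \<open>R p\<close>.\<close>
  have Wbr: "br (W a) Z $ b = - (\<Sum>p\<in>UNIV. E p $ a * br (R p) Z $ b)" for a Z b
  proof -
    have "br X (R m) $ a = (\<Sum>p\<in>UNIV. r $ p $ m * E p $ a)" for m
      unfolding E_def linear_expand_nth [OF l(1), of X "R m"] by (simp add: R_def column_def)
    moreover have "r $ p $ m = - R p $ m" for p m
      using skew2D [OF r, of p m] by (simp add: R_def column_def)
    ultimately have "W a = (\<Sum>p\<in>UNIV. E p $ a *\<^sub>R - R p)"
      by (simp add: W_def vec_eq_iff mult.commute sum_negf)
    then have "br (W a) Z = (\<Sum>p\<in>UNIV. E p $ a *\<^sub>R - br (R p) Z)"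
      by (simp add: linear_sum [OF l(2)] bilinear_lmul [OF b] bilinear_lneg [OF b])
    then show ?thesis by (simp add: sum_negf)
  qed
  have J: "(\<Sum>m\<in>UNIV. cocomm br r X $ a $ m * cocomm br r (axis m 1) $ b $ c) =
      br (W a) (R c) $ b - br (W a) (R b) $ c - br (br X (R a)) (R c) $ b + br (br X (R a)) (R b) $ c"
    for a b c
  proof -
    \<comment> \<open>Row \<open>a\<close> of the cocommutator at \<open>X\<close> is
      \<open>W a - br X (R a)\<close>; contracting over \<open>m\<close> puts this vector in place
      of the basis vector.\<close>
    have V: "(\<Sum>m\<in>UNIV. cocomm br r X $ a $ m * br (axis m 1) Z $ d) =
        br (W a) Z $ d - br (br X (R a)) Z $ d" for Z d
    proof -
      have "(\<Sum>m\<in>UNIV. cocomm br r X $ a $ m * br (axis m 1) Z $ d) = br (W a - br X (R a)) Z $ d"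
        unfolding linear_expand_nth [OF l(2), of "W a - br X (R a)"]
        by (simp add: cocomm_nth [OF \<open>bilinear br\<close> r] W_def R_def)
      then show ?thesis by (simp add: bilinear_lsub [OF b])
    qed
    show ?thesis
      by (simp add: cocomm_nth [OF b r, of "axis _ 1"] right_diff_distrib sum_subtractf V R_def [symmetric])
  qed
  \<comment> \<open>This is the action of \<open>X\<close> on the first leg only. Of the three
    cyclic summands, the first has \<open>p\<close> as the component index of its bracket; the other
    two have \<open>R p\<close> as an argument and are resummed by \<open>Wbr\<close>.\<close>
  have S: "br X (\<chi> p. schouten br r $ p $ b $ c) $ a =
      br X (br (R b) (R c)) $ a + br (W a) (R c) $ b - br (W a) (R b) $ c" for a b c
  proof -
    have a: "br (R c) (R p) = - br (R p) (R c)" for p by (rule lie_bracketD(2) [OF L])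
    show ?thesis
      unfolding linear_expand_nth [OF l(1), of X "\<chi> p. _ p"]
        linear_expand_nth [OF l(1), of X "br (R b) (R c)"] Wbr
      by (simp add: schouten_nth_skew2 [OF L r] R_def [symmetric] E_def [symmetric] a
          sum.distrib sum_negf sum_subtractf algebra_simps)
  qed
  \<comment> \<open>Rotation moves the leg on which \<open>X\<close> acts to the front, so that
    \<open>S\<close> covers all three legs.\<close>
  have cyc: "schouten br r $ a $ b $ c = schouten br r $ b $ c $ a" for a b c
    by (simp add: schouten_nth_skew2 [OF L r])
  have jac: "br X (br (R b) (R c)) $ a = br (br X (R b)) (R c) $ a - br (br X (R c)) (R b) $ a" for a b c
    by (simp add: lie_bracketD(3) [OF L, of X "R b"])
  show ?thesis
  proof (simp only: vec_eq_iff, intro allI)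
    fix a b c
    have "comm3_left br X (schouten br r) $ a $ b $ c = br X (\<chi> p. schouten br r $ p $ b $ c) $ a
        + br X (\<chi> p. schouten br r $ p $ c $ a) $ b + br X (\<chi> p. schouten br r $ p $ a $ b) $ c"
      unfolding comm3_left_nth [OF b]
      using cyc [of a _ c] cyc [of _ a b] by (simp add: cyc [of a _ c] cyc [of _ a b])
    then show "co_jacobiator (cocomm br r) X $ a $ b $ c = comm3_left br X (schouten br r) $ a $ b $ c"
      unfolding S jac by (simp add: co_jacobiator_def sum.distrib J)
  qed
qed

section \<open>The dual bracket\<close>

lemma dual_map_apply:
  assumes "linear \<delta>"
  shows "blinfun_apply (dual_map \<delta> \<phi> \<psi>) X = (\<Sum>i\<in>UNIV. \<Sum>j\<in>UNIV.
     \<delta> X $ i $ j * blinfun_apply \<phi> (axis i 1) * blinfun_apply \<psi> (axis j 1))"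
proof -
  have "linear (\<lambda>X. \<Sum>i\<in>UNIV. \<Sum>j\<in>UNIV.
     \<delta> X $ i $ j * blinfun_apply \<phi> (axis i 1) * blinfun_apply \<psi> (axis j 1))"
    by (rule linearI)
      (simp_all add: linear_add [OF assms] linear_cmul [OF assms] algebra_simps sum.distrib sum_distrib_left)
  then show ?thesis
    by (simp add: dual_map_def bounded_linear_Blinfun_apply linear_conv_bounded_linear)
qed

text \<open>The two functionals are members of the dual basis, so the entries of
  \<open>\<delta>\<close> are the structure constants of the dual bracket.\<close>

lemma dual_map_coord:
  assumes "linear \<delta>"
  shows "blinfun_apply (dual_map \<delta> (blinfun_inner_left (axis a 1)) (blinfun_inner_left (axis b 1))) X
    = \<delta> X $ a $ b"
  by (simp add: dual_map_apply [OF assms] inner_axis_axis if_distrib [of "\<lambda>x. _ * x"] cong: if_cong)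

lemma bilinear_dual_map: "linear \<delta> \<Longrightarrow> bilinear (dual_map \<delta>)"
  unfolding bilinear_def
  by (auto intro!: linearI blinfun_eqI simp: dual_map_apply blinfun.bilinear_simps algebra_simps
      sum.distrib sum_distrib_left)

text \<open>Forwards: polarization gives antisymmetry, which is then evaluated on the dual basis.
  Backwards: exchanging the summation indices shows that the double sum equals its own
  negative.\<close>

lemma dual_map_alternating_iff:
  fixes \<delta> :: "real ^ 'n \<Rightarrow> ('n::finite) tensor2"
  assumes "linear \<delta>"
  shows "(\<forall>\<phi>. dual_map \<delta> \<phi> \<phi> = 0) \<longleftrightarrow> (\<forall>X. skew2 (\<delta> X))"
proof
  assume *: "\<forall>\<phi>. dual_map \<delta> \<phi> \<phi> = 0"
  note b = bilinear_dual_map [OF assms]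
  have "dual_map \<delta> \<phi> \<psi> = - dual_map \<delta> \<psi> \<phi>" for \<phi> \<psi>
    using *[rule_format, of "\<phi> + \<psi>"] *[rule_format, of \<phi>] *[rule_format, of \<psi>]
    by (simp add: bilinear_ladd [OF b] bilinear_radd [OF b] eq_neg_iff_add_eq_0 add.commute)
  then show "\<forall>X. skew2 (\<delta> X)"
    by (metis (no_types, lifting) dual_map_coord [OF assms] skew2_def uminus_blinfun.rep_eq)
next
  assume *: "\<forall>X. skew2 (\<delta> X)"
  show "\<forall>\<phi>. dual_map \<delta> \<phi> \<phi> = 0"
  proof (intro allI blinfun_eqI)
    fix \<phi> :: "(real ^ 'n) \<Rightarrow>\<^sub>L real" and X
    let ?f = "\<lambda>i j. \<delta> X $ i $ j * blinfun_apply \<phi> (axis i 1) * blinfun_apply \<phi> (axis j 1)"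
    have "?f i j = - ?f j i" for i j
      using skew2D [of "\<delta> X" i j] * by simp
    then have "(\<Sum>i\<in>UNIV. \<Sum>j\<in>UNIV. ?f i j) = (\<Sum>i\<in>UNIV. \<Sum>j\<in>UNIV. - ?f j i)"
      by (intro sum.cong refl)
    also have "\<dots> = - (\<Sum>i\<in>UNIV. \<Sum>j\<in>UNIV. ?f j i)"
      by (simp only: sum_negf)
    also have "(\<Sum>i\<in>UNIV. \<Sum>j\<in>UNIV. ?f j i) = (\<Sum>i\<in>UNIV. \<Sum>j\<in>UNIV. ?f i j)"
      by (rule sum.swap)
    finally show "blinfun_apply (dual_map \<delta> \<phi> \<phi>) X = blinfun_apply 0 X"
      by (simp add: dual_map_apply [OF assms])
  qed
qed

text \<open>The inner sum over \<open>m\<close> is the coefficient of (1 \<otimes>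
  \<delta>)(\<delta> X); this links iterated dual brackets to \<open>co_jacobiator\<close>.\<close>

lemma dual_map_twice:
  fixes \<delta> :: "real ^ 'n \<Rightarrow> ('n::finite) tensor2"
  assumes "linear \<delta>"
  shows "blinfun_apply (dual_map \<delta> \<phi> (dual_map \<delta> \<psi> \<theta>)) X =
    (\<Sum>i\<in>UNIV. \<Sum>k\<in>UNIV. \<Sum>l\<in>UNIV. (\<Sum>m\<in>UNIV. \<delta> X $ i $ m * \<delta> (axis m 1) $ k $ l)
      * (blinfun_apply \<phi> (axis i 1) * blinfun_apply \<psi> (axis k 1) * blinfun_apply \<theta> (axis l 1)))"
    (is "_ = (\<Sum>i\<in>UNIV. ?rhs i)")
proof -
  have "(\<Sum>m\<in>UNIV. \<delta> X $ i $ m * blinfun_apply \<phi> (axis i 1) *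
      blinfun_apply (dual_map \<delta> \<psi> \<theta>) (axis m 1)) = ?rhs i" for i
  proof -
    let ?g = "\<lambda>m k l. \<delta> X $ i $ m * \<delta> (axis m 1) $ k $ l
      * (blinfun_apply \<phi> (axis i 1) * blinfun_apply \<psi> (axis k 1) * blinfun_apply \<theta> (axis l 1))"
    have "(\<Sum>m\<in>UNIV. \<delta> X $ i $ m * blinfun_apply \<phi> (axis i 1) *
        blinfun_apply (dual_map \<delta> \<psi> \<theta>) (axis m 1)) = (\<Sum>m\<in>UNIV. \<Sum>k\<in>UNIV. \<Sum>l\<in>UNIV. ?g m k l)"
      by (simp add: dual_map_apply [OF assms] sum_distrib_left mult_ac)
    also have "\<dots> = (\<Sum>k\<in>UNIV. \<Sum>m\<in>UNIV. \<Sum>l\<in>UNIV. ?g m k l)"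
      by (rule sum.swap)
    also have "\<dots> = (\<Sum>k\<in>UNIV. \<Sum>l\<in>UNIV. \<Sum>m\<in>UNIV. ?g m k l)"
      by (intro sum.cong refl sum.swap)
    finally show ?thesis by (simp add: sum_distrib_right)
  qed
  then show ?thesis
    by (simp add: dual_map_apply [OF assms, of \<phi>])
qed

text \<open>The Jacobi expression is the trilinear form whose coefficients are the entries of
  \<open>co_jacobiator \<delta> X\<close>; it vanishes identically iff it vanishes on the dual
  basis.\<close>

lemma dual_map_jacobi_iff:
  fixes \<delta> :: "real ^ 'n \<Rightarrow> ('n::finite) tensor2"
  assumes "linear \<delta>"
  shows "(\<forall>\<phi> \<psi> \<theta>. dual_map \<delta> \<phi> (dual_map \<delta> \<psi> \<theta>) + dual_map \<delta> \<psi> (dual_map \<delta> \<theta> \<phi>)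
      + dual_map \<delta> \<theta> (dual_map \<delta> \<phi> \<psi>) = 0) \<longleftrightarrow> (\<forall>X. co_jacobiator \<delta> X = 0)"
    (is "(\<forall>\<phi> \<psi> \<theta>. ?J \<phi> \<psi> \<theta> = 0) \<longleftrightarrow> _")
proof -
  have J: "blinfun_apply (?J \<phi> \<psi> \<theta>) X = (\<Sum>i\<in>UNIV. \<Sum>k\<in>UNIV. \<Sum>l\<in>UNIV. co_jacobiator \<delta> X $ i $ k $ l
      * (blinfun_apply \<phi> (axis i 1) * blinfun_apply \<psi> (axis k 1) * blinfun_apply \<theta> (axis l 1)))" for \<phi> \<psi> \<theta> X
  proof -
    define A where "A i k l = (\<Sum>m\<in>UNIV. \<delta> X $ i $ m * \<delta> (axis m 1) $ k $ l)" for i k l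
    define f g h where "f i = blinfun_apply \<phi> (axis i 1)" and "g i = blinfun_apply \<psi> (axis i 1)"
      and "h i = blinfun_apply \<theta> (axis i 1)" for i
    \<comment> \<open>Cyclic renaming of indices, used once in each direction to bring all three
      Jacobi terms to the monomial \<open>f i * g k * h l\<close>.\<close>
    have rot: "(\<Sum>i\<in>UNIV. \<Sum>k\<in>UNIV. \<Sum>l\<in>UNIV. F k l i) = (\<Sum>i\<in>UNIV. \<Sum>k\<in>UNIV. \<Sum>l\<in>UNIV. F i k l)"
      for F :: "'n \<Rightarrow> 'n \<Rightarrow> 'n \<Rightarrow> real"
    proof -
      have "(\<Sum>i\<in>UNIV. \<Sum>k\<in>UNIV. \<Sum>l\<in>UNIV. F k l i) = (\<Sum>k\<in>UNIV. \<Sum>i\<in>UNIV. \<Sum>l\<in>UNIV. F k l i)"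
        by (rule sum.swap)
      also have "\<dots> = (\<Sum>k\<in>UNIV. \<Sum>l\<in>UNIV. \<Sum>i\<in>UNIV. F k l i)"
        by (intro sum.cong refl sum.swap)
      finally show ?thesis .
    qed
    have "blinfun_apply (?J \<phi> \<psi> \<theta>) X =
        (\<Sum>i\<in>UNIV. \<Sum>k\<in>UNIV. \<Sum>l\<in>UNIV. A i k l * (f i * g k * h l))
      + (\<Sum>i\<in>UNIV. \<Sum>k\<in>UNIV. \<Sum>l\<in>UNIV. A i k l * (g i * h k * f l))
      + (\<Sum>i\<in>UNIV. \<Sum>k\<in>UNIV. \<Sum>l\<in>UNIV. A i k l * (h i * f k * g l))"
      by (simp add: blinfun.bilinear_simps dual_map_twice [OF assms] A_def f_def g_def h_def)
    also have "(\<Sum>i\<in>UNIV. \<Sum>k\<in>UNIV. \<Sum>l\<in>UNIV. A i k l * (g i * h k * f l)) =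
        (\<Sum>i\<in>UNIV. \<Sum>k\<in>UNIV. \<Sum>l\<in>UNIV. A k l i * (g k * h l * f i))"
      by (rule rot [symmetric])
    also have "(\<Sum>i\<in>UNIV. \<Sum>k\<in>UNIV. \<Sum>l\<in>UNIV. A i k l * (h i * f k * g l)) =
        (\<Sum>i\<in>UNIV. \<Sum>k\<in>UNIV. \<Sum>l\<in>UNIV. A l i k * (h l * f i * g k))"
      by (rule rot)
    finally show ?thesis
      by (simp add: co_jacobiator_def sum.distrib A_def [symmetric] f_def [symmetric] g_def [symmetric]
          h_def [symmetric] distrib_left mult_ac)
  qed
  show ?thesis
  proof
    assume *: "\<forall>\<phi> \<psi> \<theta>. ?J \<phi> \<psi> \<theta> = 0"
    show "\<forall>X. co_jacobiator \<delta> X = 0"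
    proof (simp only: vec_eq_iff zero_index, intro allI)
      fix X a b c
      have "0 = blinfun_apply (?J (blinfun_inner_left (axis a 1)) (blinfun_inner_left (axis b 1))
          (blinfun_inner_left (axis c 1))) X"
        using * by simp
      also have "\<dots> = co_jacobiator \<delta> X $ a $ b $ c"
        unfolding J by (simp add: inner_axis_axis if_distrib [of "\<lambda>x. _ * x"] cong: if_cong)
      finally show "co_jacobiator \<delta> X $ a $ b $ c = 0" by simp
    qed
  next
    assume "\<forall>X. co_jacobiator \<delta> X = 0"
    then show "\<forall>\<phi> \<psi> \<theta>. ?J \<phi> \<psi> \<theta> = 0"
      by (intro allI blinfun_eqI) (simp only: J, simp)
  qed
qed

lemma lie_bracket_dual_map_iff:
  assumes "linear \<delta>"
  shows "lie_bracket (dual_map \<delta>) \<longleftrightarrow> (\<forall>X. skew2 (\<delta> X)) \<and> (\<forall>X. co_jacobiator \<delta> X = 0)"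
  unfolding lie_bracket_def dual_map_alternating_iff [OF assms] dual_map_jacobi_iff [OF assms]
  by (simp add: bilinear_dual_map [OF assms])

section \<open>Coboundaries are cocycles, and the Lie bialgebra criterion\<close>

text \<open>The adjoint action on the tensor square is a representation, and
  \<open>comm2_right br t Y\<close> is minus the action of \<open>Y\<close> on \<open>t\<close>. So
  the claim says that the action of \<open>br X Y\<close> is the commutator of the actions of
  \<open>X\<close> and \<open>Y\<close>.\<close>

lemma cocomm_bracket:
  assumes L: "lie_bracket br"
  shows "cocomm br r (br X Y) = comm2_right br (cocomm br r X) Y + comm2_left br X (cocomm br r Y)"
proof -
  note b = lie_bracketD(1) [OF L]
  have l: "linear (br x)" "linear (\<lambda>x. br x y)" for x y
    using b by (auto simp: bilinear_def)
  \<comment> \<open>The mixed term, with \<open>V\<close> acting on the first leg and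
    \<open>U\<close> on the second. Both orders of composition produce \<open>P U V\<close> and
    \<open>P V U\<close>, so these cancel in the commutator.\<close>
  define P where "P U V a b = (\<Sum>m\<in>UNIV. br U (row m r) $ b * br V (axis m 1) $ a)" for U V a b
  have col: "br V (column b (comm2_left br U r)) $ a = br V (br U (column b r)) $ a + P U V a b" for U V a b
  proof -
    have "column b (comm2_left br U r) = br U (column b r) + (\<chi> m. br U (row m r) $ b)"
      by (simp add: vec_eq_iff column_def [of b "comm2_left br U r"] comm2_left_nth [OF b])
    then show ?thesis
      by (simp add: bilinear_radd [OF b] P_def linear_expand_nth [OF l(1), of V "\<chi> m. _ m"])
  qed
  have row: "br V (row a (comm2_left br U r)) $ b = br V (br U (row a r)) $ b + P V U a b" for U V a b
  proof -
    have "row a (comm2_left br U r) = (\<chi> m. br U (column m r) $ a) + br U (row a r)"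
      by (simp add: vec_eq_iff row_def [of a "comm2_left br U r"] comm2_left_nth [OF b])
    moreover have "br V (\<chi> m. br U (column m r) $ a) $ b = P V U a b"
    proof -
      have "br V (\<chi> m. br U (column m r) $ a) $ b
          = (\<Sum>m\<in>UNIV. (\<Sum>k\<in>UNIV. r $ k $ m * br U (axis k 1) $ a) * br V (axis m 1) $ b)"
        by (simp add: linear_expand_nth [OF l(1), of V "\<chi> m. _ m"]
            linear_expand_nth [OF l(1), of U "column _ r"]) (simp add: column_def)
      also have "\<dots> = (\<Sum>k\<in>UNIV. \<Sum>m\<in>UNIV. r $ k $ m * br U (axis k 1) $ a * br V (axis m 1) $ b)"
        unfolding sum_distrib_right by (rule sum.swap)
      also have "\<dots> = P V U a b"
        by (simp add: P_def linear_expand_nth [OF l(1), of V "row _ r"] sum_distrib_right)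
          (simp add: row_def mult_ac)
      finally show ?thesis .
    qed
    ultimately show ?thesis by (simp add: bilinear_radd [OF b])
  qed
  have R: "br (column b t) Y = - br Y (column b t)" "br (row b t) Y = - br Y (row b t)" for b t
    by (rule lie_bracketD(2) [OF L])+
  have jac: "br (br X Y) v = br X (br Y v) - br Y (br X v)" for v
    using lie_bracketD(3) [OF L, of X Y v] lie_bracketD(2) [OF L, of Y "br X v"] by simp
  show ?thesis
    by (simp add: vec_eq_iff cocomm_def comm2_left_nth [OF b, of "br X Y"]
        comm2_left_nth [OF b, of X "comm2_left br _ _"] comm2_right_nth [OF b] R col row jac)
qed

text \<open>Linearity, skewness and the cocycle identity hold for every skew \<open>r\<close>, which
  leaves only the co-Jacobi identity.\<close>

lemma lie_bialgebra_cocomm_iff: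
  assumes "lie_bracket br" "skew2 r"
  shows "lie_bialgebra br (cocomm br r) \<longleftrightarrow> (\<forall>X. comm3_left br X (schouten br r) = 0)"
  using assms lie_bracketD(1) [OF assms(1)]
  by (simp add: lie_bialgebra_def linear_cocomm lie_bracket_dual_map_iff skew2_cocomm
      co_jacobiator_cocomm cocomm_bracket)

section \<open>The Schroedinger algebra\<close>

lemma sum_gen: "(\<Sum>i\<in>UNIV. f i) = f GD + f GH + f GP + f GK + f GC + f GM"
  by (simp add: UNIV_gen add_ac)

lemma all_gen: "(\<forall>i. P i) \<longleftrightarrow> P GD \<and> P GH \<and> P GP \<and> P GK \<and> P GC \<and> P GM"
  by (metis gen.exhaust)

lemma axis_gen_nth: "axis (i::gen) (1::real) $ j = (if i = j then 1 else 0)"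
  by (simp add: axis_def)

lemma sch_bracket_nth:
  "sch_bracket x y $ GD = x $ GH * y $ GC - x $ GC * y $ GH"
  "sch_bracket x y $ GH = 2 * (x $ GH * y $ GD - x $ GD * y $ GH)"
  "sch_bracket x y $ GP = x $ GP * y $ GD - x $ GD * y $ GP + x $ GK * y $ GH - x $ GH * y $ GK"
  "sch_bracket x y $ GK = x $ GD * y $ GK - x $ GK * y $ GD + x $ GC * y $ GP - x $ GP * y $ GC"
  "sch_bracket x y $ GC = 2 * (x $ GD * y $ GC - x $ GC * y $ GD)"
  "sch_bracket x y $ GM = x $ GK * y $ GP - x $ GP * y $ GK"
  by (simp_all add: sch_bracket_def sum_gen axis_gen_nth algebra_simps)

lemma lie_bracket_sch: "lie_bracket sch_bracket"
  unfolding lie_bracket_def bilinear_def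
  by (intro conjI allI linearI; simp add: vec_eq_iff all_gen sch_bracket_nth algebra_simps)

lemmas bilinear_sch = lie_bracketD(1) [OF lie_bracket_sch]

section \<open>Coordinates of the r-matrix and of its Schouten bracket\<close>

lemma sch_r_nth:
    "sch_r a1 a2 a3 a4 a5 a6 b1 b2 b3 b4 b5 b6 c1 c2 c3 $ GD $ GD = 0"
    "sch_r a1 a2 a3 a4 a5 a6 b1 b2 b3 b4 b5 b6 c1 c2 c3 $ GD $ GH = a2"
    "sch_r a1 a2 a3 a4 a5 a6 b1 b2 b3 b4 b5 b6 c1 c2 c3 $ GD $ GP = a1"
    "sch_r a1 a2 a3 a4 a5 a6 b1 b2 b3 b4 b5 b6 c1 c2 c3 $ GD $ GK = b1"
    "sch_r a1 a2 a3 a4 a5 a6 b1 b2 b3 b4 b5 b6 c1 c2 c3 $ GD $ GC = b2"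
    "sch_r a1 a2 a3 a4 a5 a6 b1 b2 b3 b4 b5 b6 c1 c2 c3 $ GD $ GM = c1"
    "sch_r a1 a2 a3 a4 a5 a6 b1 b2 b3 b4 b5 b6 c1 c2 c3 $ GH $ GD = - a2"
    "sch_r a1 a2 a3 a4 a5 a6 b1 b2 b3 b4 b5 b6 c1 c2 c3 $ GH $ GH = 0"
    "sch_r a1 a2 a3 a4 a5 a6 b1 b2 b3 b4 b5 b6 c1 c2 c3 $ GH $ GP = - a5"
    "sch_r a1 a2 a3 a4 a5 a6 b1 b2 b3 b4 b5 b6 c1 c2 c3 $ GH $ GK = - b6"
    "sch_r a1 a2 a3 a4 a5 a6 b1 b2 b3 b4 b5 b6 c1 c2 c3 $ GH $ GC = c3"
    "sch_r a1 a2 a3 a4 a5 a6 b1 b2 b3 b4 b5 b6 c1 c2 c3 $ GH $ GM = a4"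
    "sch_r a1 a2 a3 a4 a5 a6 b1 b2 b3 b4 b5 b6 c1 c2 c3 $ GP $ GD = - a1"
    "sch_r a1 a2 a3 a4 a5 a6 b1 b2 b3 b4 b5 b6 c1 c2 c3 $ GP $ GH = a5"
    "sch_r a1 a2 a3 a4 a5 a6 b1 b2 b3 b4 b5 b6 c1 c2 c3 $ GP $ GP = 0"
    "sch_r a1 a2 a3 a4 a5 a6 b1 b2 b3 b4 b5 b6 c1 c2 c3 $ GP $ GK = c2"
    "sch_r a1 a2 a3 a4 a5 a6 b1 b2 b3 b4 b5 b6 c1 c2 c3 $ GP $ GC = a6"
    "sch_r a1 a2 a3 a4 a5 a6 b1 b2 b3 b4 b5 b6 c1 c2 c3 $ GP $ GM = a3"
    "sch_r a1 a2 a3 a4 a5 a6 b1 b2 b3 b4 b5 b6 c1 c2 c3 $ GK $ GD = - b1"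
    "sch_r a1 a2 a3 a4 a5 a6 b1 b2 b3 b4 b5 b6 c1 c2 c3 $ GK $ GH = b6"
    "sch_r a1 a2 a3 a4 a5 a6 b1 b2 b3 b4 b5 b6 c1 c2 c3 $ GK $ GP = - c2"
    "sch_r a1 a2 a3 a4 a5 a6 b1 b2 b3 b4 b5 b6 c1 c2 c3 $ GK $ GK = 0"
    "sch_r a1 a2 a3 a4 a5 a6 b1 b2 b3 b4 b5 b6 c1 c2 c3 $ GK $ GC = b5"
    "sch_r a1 a2 a3 a4 a5 a6 b1 b2 b3 b4 b5 b6 c1 c2 c3 $ GK $ GM = b3"
    "sch_r a1 a2 a3 a4 a5 a6 b1 b2 b3 b4 b5 b6 c1 c2 c3 $ GC $ GD = - b2"
    "sch_r a1 a2 a3 a4 a5 a6 b1 b2 b3 b4 b5 b6 c1 c2 c3 $ GC $ GH = - c3"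
    "sch_r a1 a2 a3 a4 a5 a6 b1 b2 b3 b4 b5 b6 c1 c2 c3 $ GC $ GP = - a6"
    "sch_r a1 a2 a3 a4 a5 a6 b1 b2 b3 b4 b5 b6 c1 c2 c3 $ GC $ GK = - b5"
    "sch_r a1 a2 a3 a4 a5 a6 b1 b2 b3 b4 b5 b6 c1 c2 c3 $ GC $ GC = 0"
    "sch_r a1 a2 a3 a4 a5 a6 b1 b2 b3 b4 b5 b6 c1 c2 c3 $ GC $ GM = b4"
    "sch_r a1 a2 a3 a4 a5 a6 b1 b2 b3 b4 b5 b6 c1 c2 c3 $ GM $ GD = - c1"
    "sch_r a1 a2 a3 a4 a5 a6 b1 b2 b3 b4 b5 b6 c1 c2 c3 $ GM $ GH = - a4"
    "sch_r a1 a2 a3 a4 a5 a6 b1 b2 b3 b4 b5 b6 c1 c2 c3 $ GM $ GP = - a3"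
    "sch_r a1 a2 a3 a4 a5 a6 b1 b2 b3 b4 b5 b6 c1 c2 c3 $ GM $ GK = - b3"
    "sch_r a1 a2 a3 a4 a5 a6 b1 b2 b3 b4 b5 b6 c1 c2 c3 $ GM $ GC = - b4"
    "sch_r a1 a2 a3 a4 a5 a6 b1 b2 b3 b4 b5 b6 c1 c2 c3 $ GM $ GM = 0"
  by (simp_all add: sch_r_def wedge2_def tens2_def axis_gen_nth)

lemma skew2_sch_r: "skew2 (sch_r a1 a2 a3 a4 a5 a6 b1 b2 b3 b4 b5 b6 c1 c2 c3)"
  by (simp add: skew2_def all_gen sch_r_nth)

text \<open>A skew array of size 6 has 15 free entries, and each of the 15 wedge products in
  \<open>sch_r\<close> occupies exactly one of them up to sign.\<close>

lemma skew2_eq_sch_r: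
  assumes "skew2 t"
  shows "t = sch_r (t $ GD $ GP) (t $ GD $ GH) (t $ GP $ GM) (t $ GH $ GM) (t $ GP $ GH) (t $ GP $ GC)
    (t $ GD $ GK) (t $ GD $ GC) (t $ GK $ GM) (t $ GC $ GM) (t $ GK $ GC) (t $ GK $ GH)
    (t $ GD $ GM) (t $ GP $ GK) (t $ GH $ GC)"
  (is "t = ?r")
proof -
  have "t $ a $ a = 0" for a using skew2D [OF assms, of a a] by simp
  then have "t $ a $ b = ?r $ a $ b" for a b
    using skew2D [OF assms, of a b] by (cases a; cases b; simp only: sch_r_nth; simp)
  then show ?thesis
    unfolding vec_eq_iff by blast
qed

text \<open>These are the 20 triples of distinct generators in the order D, H, P, K, C, M. Up to
  sign, 19 of the values are the left-hand sides in \<open>sch_equations\<close>; the remaining one,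
  at P, K, M, is the coefficient that decides between standard and non-standard.\<close>

lemma schouten_sch_r_nth:
    "schouten sch_bracket (sch_r a1 a2 a3 a4 a5 a6 b1 b2 b3 b4 b5 b6 c1 c2 c3) $ GD $ GH $ GP = a1*a2 + a2*b6 - a5*c3"
    "schouten sch_bracket (sch_r a1 a2 a3 a4 a5 a6 b1 b2 b3 b4 b5 b6 c1 c2 c3) $ GD $ GH $ GK = - a1*c3 + 3*a2*b1 - a5*b2 - b6*c3"
    "schouten sch_bracket (sch_r a1 a2 a3 a4 a5 a6 b1 b2 b3 b4 b5 b6 c1 c2 c3) $ GD $ GH $ GC = 4*a2*b2 + c3^2"
    "schouten sch_bracket (sch_r a1 a2 a3 a4 a5 a6 b1 b2 b3 b4 b5 b6 c1 c2 c3) $ GD $ GH $ GM = a1*b6 + 2*a2*c1 - a5*b1 + a4*c3"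
    "schouten sch_bracket (sch_r a1 a2 a3 a4 a5 a6 b1 b2 b3 b4 b5 b6 c1 c2 c3) $ GD $ GP $ GK = - a1*a6 + 2*a1*b1 + a5*b5 - a6*b6 - b1*b6"
    "schouten sch_bracket (sch_r a1 a2 a3 a4 a5 a6 b1 b2 b3 b4 b5 b6 c1 c2 c3) $ GD $ GP $ GC = 3*a1*b2 - a2*b5 + a6*c3 + b1*c3"
    "schouten sch_bracket (sch_r a1 a2 a3 a4 a5 a6 b1 b2 b3 b4 b5 b6 c1 c2 c3) $ GD $ GP $ GM = a1*c1 - a1*c2 - a2*b3 - a5*b4 + a4*a6 + a4*b1"
    "schouten sch_bracket (sch_r a1 a2 a3 a4 a5 a6 b1 b2 b3 b4 b5 b6 c1 c2 c3) $ GD $ GK $ GC = b1*b2 + a6*b2 + b5*c3"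
    "schouten sch_bracket (sch_r a1 a2 a3 a4 a5 a6 b1 b2 b3 b4 b5 b6 c1 c2 c3) $ GD $ GK $ GM = - a1*b4 - b1*c1 - b1*c2 + a3*b2 + a4*b5 - b4*b6"
    "schouten sch_bracket (sch_r a1 a2 a3 a4 a5 a6 b1 b2 b3 b4 b5 b6 c1 c2 c3) $ GD $ GC $ GM = a1*b5 - a6*b1 - 2*b2*c1 + b4*c3"
    "schouten sch_bracket (sch_r a1 a2 a3 a4 a5 a6 b1 b2 b3 b4 b5 b6 c1 c2 c3) $ GH $ GP $ GK = a1*b6 + a5*a6 - 3*a5*b1 + b6^2"
    "schouten sch_bracket (sch_r a1 a2 a3 a4 a5 a6 b1 b2 b3 b4 b5 b6 c1 c2 c3) $ GH $ GP $ GC = - a2*a6 - 3*a5*b2 - b6*c3"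
    "schouten sch_bracket (sch_r a1 a2 a3 a4 a5 a6 b1 b2 b3 b4 b5 b6 c1 c2 c3) $ GH $ GP $ GM = - 2*a1*a4 + a2*a3 - 3*a5*c1 + a5*c2 - a4*b6"
    "schouten sch_bracket (sch_r a1 a2 a3 a4 a5 a6 b1 b2 b3 b4 b5 b6 c1 c2 c3) $ GH $ GK $ GC = - 3*a2*b5 - b2*b6 + a6*c3"
    "schouten sch_bracket (sch_r a1 a2 a3 a4 a5 a6 b1 b2 b3 b4 b5 b6 c1 c2 c3) $ GH $ GK $ GM = - a2*b3 + a5*b4 - 2*a4*b1 - b6*c1 + b6*c2 + a3*c3"
    "schouten sch_bracket (sch_r a1 a2 a3 a4 a5 a6 b1 b2 b3 b4 b5 b6 c1 c2 c3) $ GH $ GC $ GM = - 2*a2*b4 - a5*b5 - 2*a4*b2 + a6*b6"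
    "schouten sch_bracket (sch_r a1 a2 a3 a4 a5 a6 b1 b2 b3 b4 b5 b6 c1 c2 c3) $ GP $ GK $ GC = - 3*a1*b5 + a6^2 + a6*b1 + b5*b6"
    "schouten sch_bracket (sch_r a1 a2 a3 a4 a5 a6 b1 b2 b3 b4 b5 b6 c1 c2 c3) $ GP $ GK $ GM = - a1*b3 + a3*a6 - a3*b1 + b3*b6 - c2^2"
    "schouten sch_bracket (sch_r a1 a2 a3 a4 a5 a6 b1 b2 b3 b4 b5 b6 c1 c2 c3) $ GP $ GC $ GM = - 2*a1*b4 - a6*c1 - a3*b2 + a4*b5 - a6*c2 - b3*c3"
    "schouten sch_bracket (sch_r a1 a2 a3 a4 a5 a6 b1 b2 b3 b4 b5 b6 c1 c2 c3) $ GK $ GC $ GM = - a6*b4 - 2*b1*b4 + b2*b3 - 3*b5*c1 - b5*c2"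
  by (simp_all add: schouten_nth_skew2 [OF lie_bracket_sch skew2_sch_r] sch_bracket_nth column_def
      sch_r_nth algebra_simps power2_eq_square)

section \<open>Weights and invariant skew 3-tensors\<close>

lemma skew3_gen_eqI:
  assumes "skew3 s" "skew3 t"
    and "s $ GD $ GH $ GP = t $ GD $ GH $ GP"
    "s $ GD $ GH $ GK = t $ GD $ GH $ GK"
    "s $ GD $ GH $ GC = t $ GD $ GH $ GC"
    "s $ GD $ GH $ GM = t $ GD $ GH $ GM"
    "s $ GD $ GP $ GK = t $ GD $ GP $ GK"
    "s $ GD $ GP $ GC = t $ GD $ GP $ GC"
    "s $ GD $ GP $ GM = t $ GD $ GP $ GM"
    "s $ GD $ GK $ GC = t $ GD $ GK $ GC"
    "s $ GD $ GK $ GM = t $ GD $ GK $ GM"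
    "s $ GD $ GC $ GM = t $ GD $ GC $ GM"
    "s $ GH $ GP $ GK = t $ GH $ GP $ GK"
    "s $ GH $ GP $ GC = t $ GH $ GP $ GC"
    "s $ GH $ GP $ GM = t $ GH $ GP $ GM"
    "s $ GH $ GK $ GC = t $ GH $ GK $ GC"
    "s $ GH $ GK $ GM = t $ GH $ GK $ GM"
    "s $ GH $ GC $ GM = t $ GH $ GC $ GM"
    "s $ GP $ GK $ GC = t $ GP $ GK $ GC"
    "s $ GP $ GK $ GM = t $ GP $ GK $ GM"
    "s $ GP $ GC $ GM = t $ GP $ GC $ GM"
    "s $ GK $ GC $ GM = t $ GK $ GC $ GM"
  shows "s = t"
proof -
  define Q where "Q a b c \<longleftrightarrow> s $ a $ b $ c = t $ a $ b $ c" for a b c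
  have skew: "u $ a $ b $ c = - u $ b $ a $ c" "u $ a $ b $ c = - u $ a $ c $ b" if "skew3 u"
    for u :: "gen tensor3" and a b c
    using that unfolding skew3_def by blast+
  have p: "Q b a c" "Q a c b" if "Q a b c" for a b c
    using that skew(1) [OF assms(1), of a b c] skew(1) [OF assms(2), of a b c]
      skew(2) [OF assms(1), of a b c] skew(2) [OF assms(2), of a b c]
    by (simp_all add: Q_def)
  have d: "Q a a c" "Q a c c" for a c
    using skew(1) [OF assms(1), of a a c] skew(1) [OF assms(2), of a a c]
      skew(2) [OF assms(1), of a c c] skew(2) [OF assms(2), of a c c]
    by (simp_all add: Q_def)
  \<comment> \<open>The remaining pattern with a repeated index: equal first and third
    index.\<close>
  note d' = d(1) [THEN p(2)]
  note q = assms(3-) [folded Q_def]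
  note q1 = q [THEN p(1)] and q2 = q [THEN p(2)]
  \<comment> \<open>The six orderings of each triple, as words in the two adjacent
    transpositions.\<close>
  note q' = q q1 q2 q1 [THEN p(2)] q2 [THEN p(1)] q1 [THEN p(2), THEN p(1)]
  have "Q a b c" for a b c
    by (cases a; cases b; cases c; simp only: q' d d')
  then show ?thesis by (simp add: Q_def vec_eq_iff)
qed

text \<open>The eigenvalues of the adjoint action of \<open>eD\<close>, which is diagonal in this
  basis; they grade the algebra and its tensor powers.\<close>

primrec wt :: "gen \<Rightarrow> real" where
  "wt GD = 0" | "wt GH = -2" | "wt GP = -1" | "wt GK = 1" | "wt GC = 2" | "wt GM = 0"

lemma sch_bracket_eD_nth: "sch_bracket eD v $ a = wt a * v $ a"
  by (cases a) (simp_all add: sch_bracket_nth axis_gen_nth)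

text \<open>\<open>K\<close>, \<open>M\<close>, \<open>P\<close> span an ideal, the Heisenberg
  algebra. Every element acts on it with trace zero and so annihilates its volume element; the proof
  checks this by components.\<close>

lemma comm3_left_wedge3_KMP: "comm3_left sch_bracket X (s *\<^sub>R wedge3 eK eM eP) = 0"
proof (rule skew3_gen_eqI)
  show "skew3 (comm3_left sch_bracket X (s *\<^sub>R wedge3 eK eM eP))"
    by (rule skew3_comm3_left [OF bilinear_sch])
      (simp add: skew3_def wedge3_def tens3_def algebra_simps)
qed (simp_all add: skew3_def comm3_left_nth [OF bilinear_sch] sch_bracket_nth wedge3_def tens3_def axis_gen_nth)

text \<open>Invariance under \<open>eD\<close> leaves only triples of total weight 0, namely DPK,
  HCM, DHC and PKM. The first three are killed by \<open>eP\<close>, \<open>eH\<close> and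
  \<open>eK\<close>.\<close>

lemma skew3_invariantD:
  assumes t: "skew3 t" and inv: "\<And>X. comm3_left sch_bracket X t = 0"
  shows "t $ GD $ GH $ GP = 0 \<and>
    t $ GD $ GH $ GK = 0 \<and>
    t $ GD $ GH $ GC = 0 \<and>
    t $ GD $ GH $ GM = 0 \<and>
    t $ GD $ GP $ GK = 0 \<and>
    t $ GD $ GP $ GC = 0 \<and>
    t $ GD $ GP $ GM = 0 \<and>
    t $ GD $ GK $ GC = 0 \<and>
    t $ GD $ GK $ GM = 0 \<and>
    t $ GD $ GC $ GM = 0 \<and>
    t $ GH $ GP $ GK = 0 \<and>
    t $ GH $ GP $ GC = 0 \<and>
    t $ GH $ GP $ GM = 0 \<and>
    t $ GH $ GK $ GC = 0 \<and>
    t $ GH $ GK $ GM = 0 \<and>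
    t $ GH $ GC $ GM = 0 \<and>
    t $ GP $ GK $ GC = 0 \<and>
    t $ GP $ GC $ GM = 0 \<and>
    t $ GK $ GC $ GM = 0"
proof -
  have skew: "t $ a $ b $ c = - t $ b $ a $ c" "t $ a $ b $ c = - t $ a $ c $ b" for a b c
    using t unfolding skew3_def by blast+
  have inv': "comm3_left sch_bracket X t $ a $ b $ c = 0" for X a b c
    by (simp add: inv)
  have "(wt a + wt b + wt c) * t $ a $ b $ c = 0" for a b c
    using inv' [of eD a b c]
    by (simp add: comm3_left_nth [OF bilinear_sch] sch_bracket_eD_nth algebra_simps)
  then have W: "t $ a $ b $ c = 0" if "wt a + wt b + wt c \<noteq> 0" for a b c
    using that by (metis mult_eq_0_iff)
  have diag: "t $ a $ a $ c = 0" "t $ c $ a $ a = 0" for a c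
    using skew(1) [of a a c] skew(2) [of c a a] by simp_all
  \<comment> \<open>Here and in the next two steps the entry is chosen so that, apart from
    components with a repeated index, only the wanted component survives.\<close>
  have "t $ GD $ GP $ GK = 0"
    using inv' [of eP GD GP GM]
    by (simp add: comm3_left_nth [OF bilinear_sch] sch_bracket_nth axis_gen_nth diag)
  moreover have "t $ GH $ GC $ GM = 0"
    using inv' [of eH GH GD GM]
    by (simp add: comm3_left_nth [OF bilinear_sch] sch_bracket_nth axis_gen_nth diag)
  moreover have "t $ GD $ GH $ GC = 0"
    using inv' [of eK GD GP GC]
    by (simp add: comm3_left_nth [OF bilinear_sch] sch_bracket_nth axis_gen_nth diag)
  ultimately show ?thesis by (simp add: W)
qed

text \<open>The triple K, M, P is a cyclic, hence even, rotation of P, K, M, so the coefficient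
  computed there carries over without a sign.\<close>

lemma schouten_sch_r_eq:
  assumes "sch_equations a1 a2 a3 a4 a5 a6 b1 b2 b3 b4 b5 b6 c1 c2 c3"
  shows "schouten sch_bracket (sch_r a1 a2 a3 a4 a5 a6 b1 b2 b3 b4 b5 b6 c1 c2 c3) =
    (a3*a6 + b3*b6 - a3*b1 - a1*b3 - c2^2) *\<^sub>R wedge3 eK eM eP"
proof (rule skew3_gen_eqI)
  show "skew3 (schouten sch_bracket (sch_r a1 a2 a3 a4 a5 a6 b1 b2 b3 b4 b5 b6 c1 c2 c3))"
    by (rule skew3_schouten [OF lie_bracket_sch skew2_sch_r])
qed (use assms in \<open>simp_all add: schouten_sch_r_nth sch_equations_def skew3_def wedge3_def tens3_def axis_gen_nth algebra_simps\<close>)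

lemma lie_bialgebra_sch_r_iff:
  "lie_bialgebra sch_bracket (cocomm sch_bracket (sch_r a1 a2 a3 a4 a5 a6 b1 b2 b3 b4 b5 b6 c1 c2 c3)) \<longleftrightarrow>
    sch_equations a1 a2 a3 a4 a5 a6 b1 b2 b3 b4 b5 b6 c1 c2 c3"
proof
  assume "lie_bialgebra sch_bracket (cocomm sch_bracket (sch_r a1 a2 a3 a4 a5 a6 b1 b2 b3 b4 b5 b6 c1 c2 c3))"
  then have "comm3_left sch_bracket X (schouten sch_bracket (sch_r a1 a2 a3 a4 a5 a6 b1 b2 b3 b4 b5 b6 c1 c2 c3)) = 0" for X
    by (simp add: lie_bialgebra_cocomm_iff [OF lie_bracket_sch skew2_sch_r])
  from skew3_invariantD [OF skew3_schouten [OF lie_bracket_sch skew2_sch_r] this]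
  show "sch_equations a1 a2 a3 a4 a5 a6 b1 b2 b3 b4 b5 b6 c1 c2 c3"
    unfolding schouten_sch_r_nth sch_equations_def by (simp add: algebra_simps)
next
  assume "sch_equations a1 a2 a3 a4 a5 a6 b1 b2 b3 b4 b5 b6 c1 c2 c3"
  then show "lie_bialgebra sch_bracket (cocomm sch_bracket (sch_r a1 a2 a3 a4 a5 a6 b1 b2 b3 b4 b5 b6 c1 c2 c3))"
    by (simp add: lie_bialgebra_cocomm_iff [OF lie_bracket_sch skew2_sch_r] schouten_sch_r_eq
        comm3_left_wedge3_KMP)
qed

section \<open>Cocycles\<close>

text \<open>Co-Jacobi is quadratic in \<open>\<delta>\<close> and does not pass to differences.
  These conditions are linear in \<open>\<delta>\<close>, so a coboundary may be subtracted.\<close>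

definition skew_cocycle ::
  "(real ^ 'n \<Rightarrow> real ^ 'n \<Rightarrow> real ^ 'n) \<Rightarrow> (real ^ 'n \<Rightarrow> ('n::finite) tensor2) \<Rightarrow> bool" where
  "skew_cocycle br \<delta> \<longleftrightarrow> linear \<delta> \<and> (\<forall>X. skew2 (\<delta> X)) \<and>
     (\<forall>X Y. \<delta> (br X Y) = comm2_right br (\<delta> X) Y + comm2_left br X (\<delta> Y))"

lemma lie_bialgebra_imp_skew_cocycle: "lie_bialgebra br \<delta> \<Longrightarrow> skew_cocycle br \<delta>"
  unfolding lie_bialgebra_def skew_cocycle_def using lie_bracket_dual_map_iff by blast

lemma skew_cocycle_cocomm: "lie_bracket br \<Longrightarrow> skew2 r \<Longrightarrow> skew_cocycle br (cocomm br r)"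
  by (simp add: skew_cocycle_def lie_bracketD(1) linear_cocomm skew2_cocomm cocomm_bracket)

lemma skew_cocycle_diff:
  assumes b: "bilinear br" and "skew_cocycle br \<delta>" "skew_cocycle br \<epsilon>"
  shows "skew_cocycle br (\<lambda>X. \<delta> X - \<epsilon> X)"
proof -
  have cr: "column c (s - t) = column c s - column c t" "row c (s - t) = row c s - row c t"
    for c and s t :: "'a tensor2"
    by (simp_all add: vec_eq_iff column_def row_def)
  have l: "comm2_left br X (s - t) = comm2_left br X s - comm2_left br X t"
    and r: "comm2_right br (s - t) X = comm2_right br s X - comm2_right br t X" for X s t
    by (simp_all add: vec_eq_iff comm2_left_nth [OF b] comm2_right_nth [OF b] cr
        bilinear_lsub [OF b] bilinear_rsub [OF b])
  have "skew2 (s - t)" if "skew2 s" "skew2 t" for s t :: "'a tensor2"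
    unfolding skew2_def
  proof (intro allI)
    fix i j show "(s - t) $ i $ j = - (s - t) $ j $ i"
      using skew2D [OF that(1), of i j] skew2D [OF that(2), of i j] by simp
  qed
  with assms(2,3) show ?thesis
    by (simp add: skew_cocycle_def linear_compose_sub l r)
qed

section \<open>Skew cocycles of the Schroedinger algebra modulo coboundaries\<close>

lemma normalised_sch_cocycle_eq_0:
  assumes \<delta>: "skew_cocycle sch_bracket \<delta>"
    and norm: "\<And>a b. wt a + wt b \<noteq> 0 \<Longrightarrow> \<delta> eD $ a $ b = 0"
    "\<delta> eH $ GH $ GM = 0" "\<delta> eH $ GH $ GD = 0" "\<delta> eP $ GP $ GM = 0"
  shows "\<delta> X = 0"
proof -
  have lin: "linear \<delta>" and skew: "\<And>X a b. \<delta> X $ a $ b = - \<delta> X $ b $ a"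
    using \<delta> by (auto simp: skew_cocycle_def intro: skew2D)
  have diag: "\<delta> X $ a $ a = 0" for X a
    using skew [of X a a] by simp
  have E: "\<delta> (sch_bracket X Y) $ a $ b =
      sch_bracket (column b (\<delta> X)) Y $ a + sch_bracket (row a (\<delta> X)) Y $ b
    + sch_bracket X (column b (\<delta> Y)) $ a + sch_bracket X (row a (\<delta> Y)) $ b" for X Y a b
    using \<delta> by (simp add: skew_cocycle_def comm2_left_nth [OF bilinear_sch] comm2_right_nth [OF bilinear_sch])
  note lin_simps = linear_0 [OF lin] linear_neg [OF lin] linear_cmul [OF lin]
  note simps = sch_bracket_axis lin_simps sch_bracket_nth axis_gen_nth column_def row_def diag
  have D0: "\<delta> eD $ a $ b = 0" for a b
  proof -
    \<comment> \<open>DM, HC and PK are the weight 0 pairs of distinct generators. In the identities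
      for [D,H] and [D,P], at entries of the weight of H or P, the terms in
      \<open>\<delta> eH\<close> or \<open>\<delta> eP\<close> cancel and only entries of
      \<open>\<delta> eD\<close> remain.\<close>
    have "\<delta> eD $ GD $ GM = 0"
      using E [of eD eH GH GM] norm(2) by (simp add: simps norm(1))
    moreover have "\<delta> eD $ GH $ GC = 0"
      using E [of eD eH GH GD] norm(3) skew [of eD GH GC] by (simp add: simps norm(1))
    moreover have "\<delta> eD $ GP $ GK = 0"
      using E [of eD eP GP GM] norm(4) skew [of eD GP GK] \<open>\<delta> eD $ GD $ GM = 0\<close> by (simp add: simps norm(1))
    ultimately show ?thesis
      using skew [of eD a b] by (cases a; cases b; simp add: norm(1) diag)
  qed
  \<comment> \<open>As \<open>\<delta> eD\<close> vanishes, the identity for [D,y] says that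
    \<open>\<delta>\<close> commutes with the action of \<open>eD\<close>.\<close>
  have "(wt a + wt b - wt y) * \<delta> (axis y 1) $ a $ b = 0" for y a b
  proof -
    have "sch_bracket eD (axis y 1) = wt y *\<^sub>R axis y 1"
      by (simp add: vec_eq_iff sch_bracket_eD_nth axis_gen_nth)
    moreover have "column b (\<delta> eD) = 0" "row a (\<delta> eD) = 0"
      by (simp_all add: vec_eq_iff column_def row_def D0)
    ultimately have "wt y * \<delta> (axis y 1) $ a $ b =
        sch_bracket eD (column b (\<delta> (axis y 1))) $ a + sch_bracket eD (row a (\<delta> (axis y 1))) $ b"
      using E [of eD "axis y 1" a b]
      by (simp add: linear_cmul [OF lin] bilinear_lzero [OF bilinear_sch])
    then show ?thesis
      by (simp add: sch_bracket_eD_nth column_def row_def algebra_simps)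
  qed
  then have W: "\<delta> (axis y 1) $ a $ b = 0" if "wt a + wt b \<noteq> wt y" for y a b
    using that by (metis eq_iff_diff_eq_0 mult_eq_0_iff)
  note simps = simps W norm
  have K: "\<delta> eK $ GK $ GM = 0"
    using E [of eH eK GP GM] by (simp add: simps)
  \<comment> \<open>Since \<open>eM\<close> is central, \<open>\<delta> eM\<close> is an invariant
    2-tensor.\<close>
  have M: "\<delta> eM $ GH $ GC = 0" "\<delta> eM $ GD $ GM = 0" "\<delta> eM $ GP $ GK = 0"
    using E [of eH eM GD GH] E [of eH eM GH GM] E [of eP eM GP GM] skew [of eM GC GH] skew [of eM GK GP]
    by (auto simp: simps)
  \<comment> \<open>From [H,C] = D, where \<open>\<delta> eD\<close> is already zero.\<close>
  have C: "\<delta> eC $ GC $ GM = 0" "\<delta> eC $ GD $ GC = 0"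
    using E [of eH eC GD GM] E [of eH eC GH GC] skew [of eC GC GD] D0
    by (auto simp: simps)
  \<comment> \<open>A linear system: with x = \<open>\<delta> eP $ GD $ GP\<close>, the first three
    instances of \<open>E\<close> give the other components as 2x, -x and 2x, and the fourth becomes
    6x = 0.\<close>
  have PK: "\<delta> eP $ GD $ GP = 0 \<and> \<delta> eP $ GH $ GK = 0 \<and> \<delta> eK $ GD $ GK = 0 \<and> \<delta> eK $ GP $ GC = 0"
    using E [of eH eP GH GP] E [of eH eK GH GK] E [of eP eC GP GC] E [of eP eK GP GK]
      skew [of eP GP GD] skew [of eP GK GH] skew [of eK GK GD] skew [of eK GC GP] M C
    by (simp add: simps)
  have "\<delta> (axis y 1) $ a $ b = 0" for y a b
    using skew [of "axis y 1" a b] norm(2-4) D0 K M C PK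
    by (cases y; cases a; cases b; simp add: W diag)
  then have "\<delta> (axis y 1) = 0" for y
    by (simp add: vec_eq_iff)
  then show ?thesis
    by (subst linear_expand [OF lin]) simp
qed

text \<open>Dividing by the weight inverts the action of \<open>eD\<close> off weight 0, which
  yields \<open>q\<close>. The weight 0 part of \<open>r\<close> is invisible to \<open>eD\<close>
  and is free to adjust three entries of \<open>\<delta> eH\<close> and
  \<open>\<delta> eP\<close>.\<close>

lemma sch_cocycle_imp_coboundary:
  assumes \<delta>: "skew_cocycle sch_bracket \<delta>"
  obtains r where "skew2 r" "\<delta> = cocomm sch_bracket r"
proof
  \<comment> \<open>For the \<open>r\<close> below, the cocommutator has entries
    \<open>2 * u\<close> and \<open>w\<close> at \<open>eH\<close> and \<open>u - v\<close> at
    \<open>eP\<close> in these three positions; the values are solved from equality with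
    \<open>\<delta>\<close>.\<close>
  define u w v where "u = \<delta> eH $ GH $ GM / 2" and "w = \<delta> eH $ GH $ GD" and "v = u - \<delta> eP $ GP $ GM"
  \<comment> \<open>\<open>q\<close> vanishes in weight 0 because \<open>x / 0 = 0\<close>; the weight 0 part is \<open>u D \<and> M + v P \<and> K + w H \<and> C\<close>.\<close>
  define q :: "gen tensor2" where "q = (\<chi> a b. \<delta> eD $ a $ b / (wt a + wt b))"
  define r where "r = q + sch_r 0 0 0 0 0 0 0 0 0 0 0 0 u v w"
  have q: "q $ a $ b = - q $ b $ a" for a b
    using \<delta> skew2D [of "\<delta> eD" a b] by (simp add: q_def skew_cocycle_def add.commute)
  show r: "skew2 r"
    unfolding skew2_def
  proof (intro allI)
    fix a b show "r $ a $ b = - r $ b $ a"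
      using q [of a b] skew2D [OF skew2_sch_r, of 0 0 0 0 0 0 0 0 0 0 0 0 u v w a b] by (simp add: r_def)
  qed
  have z: "sch_r 0 0 0 0 0 0 0 0 0 0 0 0 u v w $ a $ b = 0" if "wt a + wt b \<noteq> 0" for a b
    using that by (cases a; cases b; simp add: sch_r_nth)
  have r_nth: "r $ a $ b = q $ a $ b + sch_r 0 0 0 0 0 0 0 0 0 0 0 0 u v w $ a $ b" for a b
    by (simp add: r_def)
  have q_nth: "q $ a $ b = \<delta> eD $ a $ b / (wt a + wt b)" for a b
    by (simp add: q_def)
  note nth = cocomm_nth [OF bilinear_sch r]
  have diag: "q $ a $ a = 0" for a
    using q [of a a] by simp
  have "\<delta> X - cocomm sch_bracket r X = 0" for X
  proof (rule normalised_sch_cocycle_eq_0)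
    show "skew_cocycle sch_bracket (\<lambda>X. \<delta> X - cocomm sch_bracket r X)"
      by (rule skew_cocycle_diff [OF bilinear_sch \<delta> skew_cocycle_cocomm [OF lie_bracket_sch r]])
    show "(\<delta> eD - cocomm sch_bracket r eD) $ a $ b = 0" if "wt a + wt b \<noteq> 0" for a b
    proof -
      have "cocomm sch_bracket r eD $ a $ b = (wt a + wt b) * r $ a $ b"
        using skew2D [OF r, of b a]
        by (simp add: nth sch_bracket_eD_nth column_def algebra_simps)
      then show ?thesis using that by (simp add: r_nth q_nth z)
    qed
    show "(\<delta> eH - cocomm sch_bracket r eH) $ GH $ GM = 0"
      "(\<delta> eH - cocomm sch_bracket r eH) $ GH $ GD = 0"
      "(\<delta> eP - cocomm sch_bracket r eP) $ GP $ GM = 0"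
      by (simp_all add: nth sch_bracket_nth axis_gen_nth column_def r_nth diag q_nth sch_r_nth u_def v_def w_def)
  qed
  then show "\<delta> = cocomm sch_bracket r" by auto
qed

section \<open>Classification of the Lie bialgebra structures\<close>

theorem theorem2p1:
  shows "(\<forall>\<delta>. lie_bialgebra sch_bracket \<delta> \<longrightarrow> coboundary sch_bracket \<delta>)
    \<and> (\<forall>\<delta>. lie_bialgebra sch_bracket \<delta> \<longleftrightarrow>
          (\<exists>a1 a2 a3 a4 a5 a6 b1 b2 b3 b4 b5 b6 c1 c2 c3.
             sch_equations a1 a2 a3 a4 a5 a6 b1 b2 b3 b4 b5 b6 c1 c2 c3 \<and>
             \<delta> = cocomm sch_bracket (sch_r a1 a2 a3 a4 a5 a6 b1 b2 b3 b4 b5 b6 c1 c2 c3)))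
    \<and> (\<forall>a1 a2 a3 a4 a5 a6 b1 b2 b3 b4 b5 b6 c1 c2 c3.
          sch_equations a1 a2 a3 a4 a5 a6 b1 b2 b3 b4 b5 b6 c1 c2 c3 \<longrightarrow>
          (let r = sch_r a1 a2 a3 a4 a5 a6 b1 b2 b3 b4 b5 b6 c1 c2 c3;
               s = a3*a6 + b3*b6 - a3*b1 - a1*b3 - c2^2
           in schouten sch_bracket r = s *\<^sub>R wedge3 eK eM eP
              \<and> (s \<noteq> 0 \<longrightarrow> standard_r sch_bracket r)
              \<and> (s = 0 \<longrightarrow> nonstandard_r sch_bracket r)))"
proof (intro conjI allI impI)
  fix \<delta> assume "lie_bialgebra sch_bracket \<delta>"
  then show "coboundary sch_bracket \<delta>"
    unfolding coboundary_def
    by (metis lie_bialgebra_imp_skew_cocycle sch_cocycle_imp_coboundary)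
next
  fix \<delta>
  show "lie_bialgebra sch_bracket \<delta> \<longleftrightarrow>
      (\<exists>a1 a2 a3 a4 a5 a6 b1 b2 b3 b4 b5 b6 c1 c2 c3.
         sch_equations a1 a2 a3 a4 a5 a6 b1 b2 b3 b4 b5 b6 c1 c2 c3 \<and>
         \<delta> = cocomm sch_bracket (sch_r a1 a2 a3 a4 a5 a6 b1 b2 b3 b4 b5 b6 c1 c2 c3))"
    (is "?L \<longleftrightarrow> ?R")
  proof
    assume L: ?L
    then obtain r where r: "skew2 r" "\<delta> = cocomm sch_bracket r"
      using lie_bialgebra_imp_skew_cocycle sch_cocycle_imp_coboundary by blast
    note r_eq = skew2_eq_sch_r [OF r(1)]
    have "\<delta> = cocomm sch_bracket (sch_r (r $ GD $ GP) (r $ GD $ GH) (r $ GP $ GM) (r $ GH $ GM)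
        (r $ GP $ GH) (r $ GP $ GC) (r $ GD $ GK) (r $ GD $ GC) (r $ GK $ GM) (r $ GC $ GM)
        (r $ GK $ GC) (r $ GK $ GH) (r $ GD $ GM) (r $ GP $ GK) (r $ GH $ GC))"
      using r(2) by (simp only: r_eq [symmetric])
    then show ?R
      using L lie_bialgebra_sch_r_iff by metis
  next
    assume ?R
    then show ?L by (auto simp: lie_bialgebra_sch_r_iff)
  qed
next
  fix a1 a2 a3 a4 a5 a6 b1 b2 b3 b4 b5 b6 c1 c2 c3 :: real
  assume eqs: "sch_equations a1 a2 a3 a4 a5 a6 b1 b2 b3 b4 b5 b6 c1 c2 c3"
  define r s where "r = sch_r a1 a2 a3 a4 a5 a6 b1 b2 b3 b4 b5 b6 c1 c2 c3"
    and "s = a3*a6 + b3*b6 - a3*b1 - a1*b3 - c2^2"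
  have S: "schouten sch_bracket r = s *\<^sub>R wedge3 eK eM eP"
    unfolding r_def s_def by (rule schouten_sch_r_eq [OF eqs])
  have c: "classical_r_matrix sch_bracket r"
    using eqs by (simp add: classical_r_matrix_def r_def skew2_sch_r lie_bialgebra_sch_r_iff)
  \<comment> \<open>One nonzero entry shows that the wedge is nonzero, so the Schouten bracket
    vanishes exactly when \<open>s = 0\<close>.\<close>
  have "wedge3 eK eM eP $ GK $ GM $ GP = 1"
    by (simp add: wedge3_def tens3_def axis_gen_nth)
  then have "wedge3 eK eM eP \<noteq> 0" by auto
  then show "let r = sch_r a1 a2 a3 a4 a5 a6 b1 b2 b3 b4 b5 b6 c1 c2 c3;
               s = a3*a6 + b3*b6 - a3*b1 - a1*b3 - c2^2
           in schouten sch_bracket r = s *\<^sub>R wedge3 eK eM eP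
              \<and> (s \<noteq> 0 \<longrightarrow> standard_r sch_bracket r)
              \<and> (s = 0 \<longrightarrow> nonstandard_r sch_bracket r)"
    unfolding Let_def r_def [symmetric] s_def [symmetric]
    by (simp add: S c standard_r_def nonstandard_r_def comm3_left_wedge3_KMP)
qed

end
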